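(* Let $H$ be a finite-dimensional Hilbert space. There is a canonical correspondence between reflexive quantum graphs $(\mathrm{End}(H),G)$ on the endomorphism algebra of $H$ and operator systems on $H$.
   Context: All Hilbert spaces are finite-dimensional and complex; coherence isomorphisms of $\otimes$ are suppressed. A quantum set is a special symmetric dagger Frobenius algebra: a Hilbert space $A$ with linear maps $m_A:A\otimes A\to A$, $u_A:\mathbb{C}\to A$ forming an associative unital algebra such that, writing $\Delta_A=m_A^\dagger$, $\epsilon_A=u_A^\dagger$, one has $(m_A\otimes \mathrm{id})(\mathrm{id}\otimes\Delta_A)=\Delta_A m_A=(\mathrm{id}\otimes m_A)(\Delta_A\otimes\mathrm{id})$, $m_A\Delta_A=\mathrm{id}_A$, and $\epsilon_A m_A\sigma=\epsilon_A m_A$ with $\sigma$ the swap map. Every finite-dimensional $C^*$-algebra has an inner product making it a quantum set; for $A=\mathrm{End}(H)$ with operator multiplication this is $\langle x,y\rangle=\dim(H)\,\mathrm{Tr}(x^\dagger y)$. A quantum graph is a pair $(A,G)$ of a quantum set $A$ and a self-adjoint linear map $G:A\to A$ with $m_A(G\otimes G)\Delta_A=G$ and $(\mathrm{id}_A\otimes\epsilon_Am_A)(\mathrm{id}_A\otimes G\otimes\mathrm{id}_A)(\Delta_Au_A\otimes\mathrm{id}_A)=G$. It is reflexive if moreover $m_A(G\otimes\mathrm{id}_A)\Delta_A=\mathrm{id}_A$. An operator system on $H$ is a linear subspace $\mathcal V\subseteq\mathrm{End}(H)$ such that $X\in\mathcal V$ implies $X^\dagger\in\mathcal V$, and $\mathbb{1}_H\in\mathcal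 V$. *)

theory Defs
  imports Complex_Main
begin

section \<open>Finite-dimensional complex Hilbert spaces\<close>

class complex_vector = ab_group_add +
  fixes scaleC :: "complex \<Rightarrow> 'a \<Rightarrow> 'a" (infixr \<open>*\<^sub>C\<close> 75)
  assumes scaleC_add_right: "a *\<^sub>C (x + y) = a *\<^sub>C x + a *\<^sub>C y"
    and scaleC_add_left: "(a + b) *\<^sub>C x = a *\<^sub>C x + b *\<^sub>C x"
    and scaleC_scaleC: "a *\<^sub>C b *\<^sub>C x = (a * b) *\<^sub>C x"
    and scaleC_one: "1 *\<^sub>C x = x"

global_interpretation cvec: vector_space "scaleC :: complex \<Rightarrow> 'a \<Rightarrow> 'a::complex_vector"
  by unfold_locales (simp_all add: scaleC_add_right scaleC_add_left scaleC_scaleC scaleC_one)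

abbreviation clinear :: "('a::complex_vector \<Rightarrow> 'b::complex_vector) \<Rightarrow> bool" where
  "clinear \<equiv> Vector_Spaces.linear scaleC scaleC"

lemma clinear_iff:
  "clinear f \<longleftrightarrow> (\<forall>x y. f (x + y) = f x + f y) \<and> (\<forall>c x. f (c *\<^sub>C x) = c *\<^sub>C f x)"
  by (auto simp: Vector_Spaces.linear_iff cvec.vector_space_axioms)

text \<open>The inner product is antilinear in the first and linear in the second argument.
  The zero space is not excluded; completeness is automatic in finite dimension.\<close>

class fd_hilbert = complex_vector +
  fixes cinner :: "'a \<Rightarrow> 'a \<Rightarrow> complex"
  assumes cinner_commute: "cinner x y = cnj (cinner y x)"
    and cinner_add_right: "cinner x (y + z) = cinner x y + cinner x z"
    and cinner_scaleC_right: "cinner x (c *\<^sub>C y) = c * cinner x y"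
    and cinner_pos: "x \<noteq> 0 \<Longrightarrow> 0 < Re (cinner x x)"
    and finite_combination: "\<exists>B. finite B \<and> (\<forall>x. \<exists>c. x = (\<Sum>b\<in>B. c b *\<^sub>C b))"

lemma finite_spanning: "\<exists>B :: 'a::fd_hilbert set. finite B \<and> cvec.span B = UNIV"
proof -
  obtain B :: "'a set" where B: "finite B" "\<forall>x. \<exists>c. x = (\<Sum>b\<in>B. c b *\<^sub>C b)"
    using finite_combination by blast
  have "x \<in> cvec.span B" for x
  proof -
    obtain c where "x = (\<Sum>b\<in>B. c b *\<^sub>C b)" using B(2) by blast
    then show ?thesis by (simp add: cvec.span_sum cvec.span_scale cvec.span_base)
  qed
  then show ?thesis using B(1) by blast
qed

lemma clinear_add_scaleC: "clinear (f :: 'a::complex_vector \<Rightarrow> 'b::complex_vector) \<Longrightarrow> f (x + y) = f x + f y"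
  "clinear f \<Longrightarrow> f (c *\<^sub>C x) = c *\<^sub>C f x"
  by (auto simp: clinear_iff)

lemma clinear_zero: "clinear f \<Longrightarrow> f 0 = 0"
  using clinear_add_scaleC(1)[of f 0 0] by simp

lemma clinear_sum: "clinear f \<Longrightarrow> f (\<Sum>i\<in>I. g i) = (\<Sum>i\<in>I. f (g i))"
  by (induction I rule: infinite_finite_induct) (simp_all add: clinear_zero[of f] clinear_add_scaleC[of f])

lemma cinner_zero_right [simp]: "cinner x 0 = 0"
  using cinner_add_right[of x 0 0] by simp

lemma cinner_zero_left [simp]: "cinner 0 x = 0"
  by (subst cinner_commute) simp

lemma cinner_add_left: "cinner (x + y) z = cinner x z + cinner y z"
  by (subst (1 2 3) cinner_commute) (simp add: cinner_add_right)

lemma cinner_scaleC_left: "cinner (c *\<^sub>C x) y = cnj c * cinner x y"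
  by (subst (1 2) cinner_commute) (simp add: cinner_scaleC_right)

lemma cinner_minus_right: "cinner x (y - z) = cinner x y - cinner x z"
  using cinner_add_right[of x "y - z" z] by simp

lemma cinner_minus_left: "cinner (x - y) z = cinner x z - cinner y z"
  using cinner_add_left[of "x - y" y z] by simp

lemma cinner_sum_right: "cinner x (\<Sum>i\<in>I. f i) = (\<Sum>i\<in>I. cinner x (f i))"
  by (induction I rule: infinite_finite_induct) (auto simp: cinner_add_right)

lemma cinner_sum_left: "cinner (\<Sum>i\<in>I. f i) x = (\<Sum>i\<in>I. cinner (f i) x)"
  by (induction I rule: infinite_finite_induct) (auto simp: cinner_add_left)

lemma cinner_self_eq_0 [simp]: "cinner x x = 0 \<longleftrightarrow> x = 0"
proof
  show "x = 0" if "cinner x x = 0"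
    using cinner_pos[of x] that by (cases "x = 0") auto
qed simp

lemma cinner_self_real: "cinner x x = complex_of_real (Re (cinner x x))"
proof -
  have "Im (cinner x x) = Im (cnj (cinner x x))" by (rule arg_cong[OF cinner_commute])
  then show ?thesis by (simp add: complex_eq_iff)
qed

lemma cinner_ext: "(\<And>z. cinner z x = cinner z y) \<Longrightarrow> x = y"
  using cinner_self_eq_0[of "x - y"] by (simp add: cinner_minus_right)

definition orthonormal :: "'a::fd_hilbert set \<Rightarrow> bool" where
  "orthonormal B \<longleftrightarrow> (\<forall>x\<in>B. \<forall>y\<in>B. cinner x y = (if x = y then 1 else 0))"

definition is_onb :: "'a::fd_hilbert set \<Rightarrow> bool" where
  "is_onb B \<longleftrightarrow> finite B \<and> orthonormal B \<and> cvec.span B = UNIV"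

text \<open>A fixed orthonormal basis. It is only used to write down basis-independent notions.\<close>

definition onb :: "'a::fd_hilbert set" where
  "onb = (SOME B. is_onb B)"

lemma gram_schmidt:
  assumes "finite (B :: 'a::fd_hilbert set)"
  shows "\<exists>C. finite C \<and> orthonormal C \<and> cvec.span C = cvec.span B"
  using assms
proof (induction B)
  case empty
  show ?case by (intro exI[of _ "{}"]) (simp add: orthonormal_def)
next
  case (insert b B)
  then obtain C where C: "finite C" "orthonormal C" "cvec.span C = cvec.span B" by blast
  define s where "s = (\<Sum>e\<in>C. cinner e b *\<^sub>C e)"
  define r where "r = b - s"
  have s_span: "s \<in> cvec.span C"
    unfolding s_def by (intro cvec.span_sum cvec.span_scale cvec.span_base)
  have orth: "cinner e r = 0" if "e \<in> C" for e
  proof -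
    have "cinner e s = (\<Sum>f\<in>C. cinner f b * cinner e f)"
      by (simp add: s_def cinner_sum_right cinner_scaleC_right)
    also have "\<dots> = (\<Sum>f\<in>C. if f = e then cinner e b else 0)"
      using C(2) that by (intro sum.cong) (auto simp: orthonormal_def)
    also have "\<dots> = cinner e b" using C(1) that by simp
    finally show ?thesis by (simp add: r_def cinner_minus_right)
  qed
  have b_eq: "b = r + s" by (simp add: r_def)
  have B_sub: "cvec.span B \<subseteq> cvec.span (insert b B)" by (rule cvec.span_mono) auto
  show ?case
  proof (cases "r = 0")
    case True
    then have "b \<in> cvec.span B" using s_span C(3) b_eq by simp
    then have "cvec.span (insert b B) = cvec.span B" by (rule cvec.span_redundant)
    then show ?thesis using C by auto
  next
    case False
    define k where "k = complex_of_real (1 / sqrt (Re (cinner r r)))"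
    define e where "e = k *\<^sub>C r"
    have pos: "0 < Re (cinner r r)" using False by (rule cinner_pos)
    then have k0: "k \<noteq> 0" by (simp add: k_def)
    have "cinner e e = cnj k * (k * cinner r r)"
      by (simp add: e_def cinner_scaleC_left cinner_scaleC_right)
    also have "\<dots> = cnj k * (k * complex_of_real (Re (cinner r r)))"
      by (subst cinner_self_real) (rule refl)
    also have "\<dots> = complex_of_real
        ((1 / sqrt (Re (cinner r r))) * (1 / sqrt (Re (cinner r r)) * Re (cinner r r)))"
      unfolding k_def complex_cnj_complex_of_real by (simp only: of_real_mult)
    also have "(1 / sqrt (Re (cinner r r))) * (1 / sqrt (Re (cinner r r)) * Re (cinner r r)) = 1"
      using pos by simp
    finally have ee: "cinner e e = 1" by simp
    have oe: "cinner f e = 0" if "f \<in> C" for f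
      using orth[OF that] by (simp add: e_def cinner_scaleC_right)
    have eo: "cinner e f = 0" if "f \<in> C" for f
      using oe[OF that] by (subst cinner_commute) simp
    have "e \<notin> C" using ee oe[of e] by auto
    then have on: "orthonormal (insert e C)"
      using C(2) ee oe eo unfolding orthonormal_def by auto
    have re: "r = inverse k *\<^sub>C e"
      using k0 by (simp add: e_def)
    have "cvec.span (insert e C) = cvec.span (insert b B)"
    proof
      have "s \<in> cvec.span (insert b B)" using s_span C(3) B_sub by auto
      then have "r \<in> cvec.span (insert b B)"
        unfolding r_def by (simp add: cvec.span_diff cvec.span_base)
      then have "e \<in> cvec.span (insert b B)" unfolding e_def by (rule cvec.span_scale)
      moreover have "C \<subseteq> cvec.span (insert b B)"
        using C(3) B_sub cvec.span_superset[of C] by auto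
      ultimately show "cvec.span (insert e C) \<subseteq> cvec.span (insert b B)"
        by (intro cvec.span_minimal cvec.subspace_span) auto
      have "cvec.span C \<subseteq> cvec.span (insert e C)" by (rule cvec.span_mono) auto
      moreover have "r \<in> cvec.span (insert e C)"
        unfolding re by (intro cvec.span_scale cvec.span_base) auto
      ultimately have "b \<in> cvec.span (insert e C)" "B \<subseteq> cvec.span (insert e C)"
        using s_span C(3) cvec.span_superset[of B] 
        by (auto simp: b_eq intro!: cvec.span_add)
      then show "cvec.span (insert b B) \<subseteq> cvec.span (insert e C)"
        by (intro cvec.span_minimal cvec.subspace_span) auto
    qed
    then show ?thesis using C(1) on by (intro exI[of _ "insert e C"]) auto
  qed
qed

lemma is_onb_onb: "is_onb (onb :: 'a::fd_hilbert set)"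
proof -
  obtain B :: "'a set" where B: "finite B" "cvec.span B = UNIV"
    using finite_spanning by blast
  from gram_schmidt[OF B(1)] B(2) have "\<exists>C :: 'a set. is_onb C" by (auto simp: is_onb_def)
  then show ?thesis unfolding onb_def by (rule someI_ex)
qed

lemma finite_onb [simp]: "finite onb"
  using is_onb_onb unfolding is_onb_def by blast

lemma onb_expand:
  assumes "is_onb B"
  shows "(\<Sum>e\<in>B. cinner e x *\<^sub>C e) = x"
proof -
  have fin: "finite B" and on: "orthonormal B" and "x \<in> cvec.span B"
    using assms by (auto simp: is_onb_def)
  from this(3) show ?thesis
  proof (induction rule: cvec.span_induct_alt)
    case base
    show ?case by simp
  next
    case (step c b y)
    have "(\<Sum>e\<in>B. cinner e (c *\<^sub>C b + y) *\<^sub>C e)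
        = (\<Sum>e\<in>B. (if e = b then c *\<^sub>C b else 0)) + (\<Sum>e\<in>B. cinner e y *\<^sub>C e)"
      unfolding sum.distrib[symmetric] using on step(1)
      by (intro sum.cong)
        (auto simp: orthonormal_def cinner_add_right cinner_scaleC_right scaleC_add_left)
    then show ?case using fin step by simp
  qed
qed

lemma parseval:
  assumes "is_onb B"
  shows "(\<Sum>e\<in>B. cinner x e * cinner e y) = cinner x y"
proof -
  have "cinner x y = cinner x (\<Sum>e\<in>B. cinner e y *\<^sub>C e)" using onb_expand[OF assms] by simp
  also have "\<dots> = (\<Sum>e\<in>B. cinner x e * cinner e y)"
    by (simp add: cinner_sum_right cinner_scaleC_right mult.commute)
  finally show ?thesis by simp
qed

instantiation complex :: fd_hilbert
begin

definition "scaleC_complex (c :: complex) (x :: complex) = c * x"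
definition "cinner_complex (x :: complex) y = cnj x * y"

instance
proof
  fix a b x y z :: complex
  show "a *\<^sub>C (x + y) = a *\<^sub>C x + a *\<^sub>C y" "(a + b) *\<^sub>C x = a *\<^sub>C x + b *\<^sub>C x"
    "a *\<^sub>C b *\<^sub>C x = (a * b) *\<^sub>C x" "1 *\<^sub>C x = x"
    by (simp_all add: scaleC_complex_def algebra_simps)
  show "cinner x y = cnj (cinner y x)" "cinner x (y + z) = cinner x y + cinner x z"
    "cinner x (a *\<^sub>C y) = a * cinner x y"
    by (simp_all add: cinner_complex_def scaleC_complex_def algebra_simps)
  show "x \<noteq> 0 \<Longrightarrow> 0 < Re (cinner x x)"
    by (auto simp: cinner_complex_def complex_eq_iff add_pos_nonneg add_nonneg_pos
        zero_less_mult_iff sum_squares_gt_zero_iff)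
next
  show "\<exists>B :: complex set. finite B \<and> (\<forall>x. \<exists>c. x = (\<Sum>b\<in>B. c b *\<^sub>C b))"
    by (intro exI[of _ "{1}"]) (auto simp: scaleC_complex_def intro: exI[of _ "\<lambda>_. x" for x])
qed

end


section \<open>Adjoints\<close>

definition cadjoint :: "('a::fd_hilbert \<Rightarrow> 'b::fd_hilbert) \<Rightarrow> 'b \<Rightarrow> 'a"
    (\<open>_\<^sup>\<dagger>\<close> [1000] 1000) where
  "f\<^sup>\<dagger> = (SOME g. \<forall>x y. cinner (f x) y = cinner x (g y))"

lemma cadjoint:
  assumes "clinear f"
  shows "cinner (f x) y = cinner x (f\<^sup>\<dagger> y)"
proof -
  define g where "g = (\<lambda>y. \<Sum>e\<in>onb. cinner (f e) y *\<^sub>C e)"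
  have g: "cinner (f x) y = cinner x (g y)" for x y
  proof -
    have "f x = f (\<Sum>e\<in>onb. cinner e x *\<^sub>C e)" by (simp add: onb_expand[OF is_onb_onb])
    also have "\<dots> = (\<Sum>e\<in>onb. cinner e x *\<^sub>C f e)"
      by (simp add: clinear_sum[OF assms] clinear_add_scaleC[OF assms])
    finally have "cinner (f x) y = (\<Sum>e\<in>onb. cnj (cinner e x) * cinner (f e) y)"
      by (simp add: cinner_sum_left cinner_scaleC_left)
    also have "\<dots> = (\<Sum>e\<in>onb. cinner (f e) y * cinner x e)"
      by (simp add: mult.commute flip: cinner_commute)
    also have "\<dots> = cinner x (g y)" by (simp add: g_def cinner_sum_right cinner_scaleC_right)
    finally show ?thesis .
  qed
  then have "\<exists>g. \<forall>x y. cinner (f x) y = cinner x (g y)"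
    by (intro exI[of _ g] allI)
  then have "\<forall>x y. cinner (f x) y = cinner x (f\<^sup>\<dagger> y)"
    unfolding cadjoint_def by (rule someI_ex)
  then show ?thesis by blast
qed

lemma cadjoint_unique:
  assumes "\<And>x y. cinner (f x) y = cinner x (g y)"
  shows "f\<^sup>\<dagger> = g"
proof -
  have "\<exists>g. \<forall>x y. cinner (f x) y = cinner x (g y)"
    by (intro exI[of _ g] allI assms)
  then have *: "\<forall>x y. cinner (f x) y = cinner x (f\<^sup>\<dagger> y)"
    unfolding cadjoint_def by (rule someI_ex)
  show ?thesis
  proof (rule ext, rule cinner_ext)
    show "cinner x ((f\<^sup>\<dagger>) y) = cinner x (g y)" for x y
      using *[rule_format, of x y] assms[of x y] by (rule trans[OF sym])
  qed
qed

lemma clinear_cadjoint: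
  assumes "clinear f"
  shows "clinear (f\<^sup>\<dagger>)"
  unfolding clinear_iff
proof (intro conjI allI)
  show "f\<^sup>\<dagger> (x + y) = f\<^sup>\<dagger> x + f\<^sup>\<dagger> y" for x y
    by (rule cinner_ext) (simp add: cinner_add_right flip: cadjoint[OF assms])
  show "f\<^sup>\<dagger> (c *\<^sub>C x) = c *\<^sub>C f\<^sup>\<dagger> x" for c x
    by (rule cinner_ext) (simp add: cinner_scaleC_right flip: cadjoint[OF assms])
qed

definition ctrace :: "('a::fd_hilbert \<Rightarrow> 'a) \<Rightarrow> complex" where
  "ctrace f = (\<Sum>e\<in>onb. cinner e (f e))"

lemma ctrace_any_onb:
  assumes "clinear f" "is_onb B"
  shows "ctrace f = (\<Sum>b\<in>B. cinner b (f b))"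
proof -
  have adj: "cinner x (f y) = cinner (f\<^sup>\<dagger> x) y" for x y
  proof -
    have "cinner x (f y) = cnj (cinner (f y) x)" by (rule cinner_commute)
    also have "\<dots> = cnj (cinner y (f\<^sup>\<dagger> x))" by (simp only: cadjoint[OF assms(1)])
    also have "\<dots> = cinner (f\<^sup>\<dagger> x) y" by (rule cinner_commute[symmetric])
    finally show ?thesis .
  qed
  have "ctrace f = (\<Sum>e\<in>onb. \<Sum>b\<in>B. cinner e b * cinner b (f e))"
    by (simp add: ctrace_def parseval[OF assms(2)])
  also have "\<dots> = (\<Sum>b\<in>B. \<Sum>e\<in>onb. cinner e b * cinner b (f e))"
    by (rule sum.swap)
  also have "\<dots> = (\<Sum>b\<in>B. \<Sum>e\<in>onb. cinner (f\<^sup>\<dagger> b) e * cinner e b)"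
    by (simp add: adj mult.commute)
  also have "\<dots> = (\<Sum>b\<in>B. cinner b (f b))"
    by (simp add: parseval[OF is_onb_onb] adj)
  finally show ?thesis .
qed


section \<open>Tensor products\<close>

text \<open>The tensor product is modelled by the forms that are antilinear in both
  arguments, with \<open>x \<otimes> y\<close> the form \<open>(a, b) \<mapsto> \<langle>a, x\<rangle> \<langle>b, y\<rangle>\<close>; in finite dimension
  this is the usual tensor product, see \<open>tlift_tensor\<close> and \<open>cinner_tensor\<close> below.\<close>

typedef (overloaded) ('a::fd_hilbert, 'b::fd_hilbert) tensor =
  "{t :: 'a \<Rightarrow> 'b \<Rightarrow> complex.
     (\<forall>x x' y. t (x + x') y = t x y + t x' y) \<and> (\<forall>c x y. t (c *\<^sub>C x) y = cnj c * t x y) \<and>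
     (\<forall>x y y'. t x (y + y') = t x y + t x y') \<and> (\<forall>c x y. t x (c *\<^sub>C y) = cnj c * t x y)}"
  morphisms tensor_form Abs_tensor
  by (rule exI[of _ "\<lambda>_ _. 0"]) simp

setup_lifting type_definition_tensor

lemma tensor_form_add_left: "tensor_form t (x + x') y = tensor_form t x y + tensor_form t x' y"
  and tensor_form_scale_left: "tensor_form t (c *\<^sub>C x) y = cnj c * tensor_form t x y"
  and tensor_form_add_right: "tensor_form t x (y + y') = tensor_form t x y + tensor_form t x y'"
  and tensor_form_scale_right: "tensor_form t x (c *\<^sub>C y) = cnj c * tensor_form t x y"
  using tensor_form[of t] by auto

lemma tensor_form_zero_left [simp]: "tensor_form t 0 y = 0"
  using tensor_form_add_left[of t 0 0 y] by simp

lemma tensor_form_zero_right [simp]: "tensor_form t x 0 = 0"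
  using tensor_form_add_right[of t x 0 0] by simp

lemma tensor_form_sum_left: "tensor_form t (\<Sum>i\<in>I. f i) y = (\<Sum>i\<in>I. tensor_form t (f i) y)"
  by (induction I rule: infinite_finite_induct) (auto simp: tensor_form_add_left)

lemma tensor_form_sum_right: "tensor_form t x (\<Sum>i\<in>I. f i) = (\<Sum>i\<in>I. tensor_form t x (f i))"
  by (induction I rule: infinite_finite_induct) (auto simp: tensor_form_add_right)

lemma tensor_form_expand:
  "tensor_form t x y = (\<Sum>e\<in>onb. \<Sum>f\<in>onb. cinner x e * cinner y f * tensor_form t e f)"
proof -
  have "tensor_form t x y =
      tensor_form t (\<Sum>e\<in>onb. cinner e x *\<^sub>C e) (\<Sum>f\<in>onb. cinner f y *\<^sub>C f)"
    by (simp add: onb_expand[OF is_onb_onb])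
  also have "\<dots> = (\<Sum>e\<in>onb. \<Sum>f\<in>onb. cnj (cinner e x) * cnj (cinner f y) * tensor_form t e f)"
    by (simp only: tensor_form_sum_left, simp only: tensor_form_sum_right)
      (simp add: tensor_form_scale_left tensor_form_scale_right ac_simps)
  finally show ?thesis by (simp flip: cinner_commute)
qed

instantiation tensor :: (fd_hilbert, fd_hilbert) complex_vector
begin

lift_definition zero_tensor :: "('a, 'b) tensor" is "\<lambda>_ _. 0" by simp
lift_definition plus_tensor :: "('a, 'b) tensor \<Rightarrow> ('a, 'b) tensor \<Rightarrow> ('a, 'b) tensor"
  is "\<lambda>s t x y. s x y + t x y" by (simp add: algebra_simps)
lift_definition minus_tensor :: "('a, 'b) tensor \<Rightarrow> ('a, 'b) tensor \<Rightarrow> ('a, 'b) tensor"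
  is "\<lambda>s t x y. s x y - t x y" by (simp add: algebra_simps)
lift_definition uminus_tensor :: "('a, 'b) tensor \<Rightarrow> ('a, 'b) tensor"
  is "\<lambda>t x y. - t x y" by simp
lift_definition scaleC_tensor :: "complex \<Rightarrow> ('a, 'b) tensor \<Rightarrow> ('a, 'b) tensor"
  is "\<lambda>c t x y. c * t x y" by (simp add: algebra_simps)

instance
  by standard (transfer; simp add: fun_eq_iff algebra_simps)+

end

lift_definition tensor :: "'a::fd_hilbert \<Rightarrow> 'b::fd_hilbert \<Rightarrow> ('a, 'b) tensor"
    (infixr \<open>\<otimes>\<close> 72)
  is "\<lambda>x y a b. cinner a x * cinner b y"
  by (simp add: cinner_add_left cinner_scaleC_left algebra_simps)

lemma tensor_add_left: "(x + x') \<otimes> y = x \<otimes> y + x' \<otimes> y"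
  and tensor_add_right: "x \<otimes> (y + y') = x \<otimes> y + x \<otimes> y'"
  and tensor_scaleC_left: "(c *\<^sub>C x) \<otimes> y = c *\<^sub>C (x \<otimes> y)"
  and tensor_scaleC_right: "x \<otimes> (c *\<^sub>C y) = c *\<^sub>C (x \<otimes> y)"
  by (transfer; simp add: fun_eq_iff cinner_add_right cinner_scaleC_right algebra_simps)+

lemma tensor_form_plus: "tensor_form (s + t) x y = tensor_form s x y + tensor_form t x y"
  and tensor_form_scaleC: "tensor_form (c *\<^sub>C t) x y = c * tensor_form t x y"
  and tensor_form_zero: "tensor_form 0 x y = 0"
  and tensor_form_tensor: "tensor_form (p \<otimes> q) x y = cinner x p * cinner y q"
  by (transfer; simp)+

lemma tensor_form_sum: "tensor_form (\<Sum>i\<in>I. s i) x y = (\<Sum>i\<in>I. tensor_form (s i) x y)"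
  by (induction I rule: infinite_finite_induct) (auto simp: tensor_form_plus tensor_form_zero)

lemma tensor_expand:
  "t = (\<Sum>e\<in>onb. \<Sum>f\<in>onb. tensor_form t e f *\<^sub>C (e \<otimes> f))"
proof -
  have "tensor_form t x y = tensor_form (\<Sum>e\<in>onb. \<Sum>f\<in>onb. tensor_form t e f *\<^sub>C (e \<otimes> f)) x y"
    for x y
    by (subst tensor_form_expand)
      (simp add: tensor_form_sum tensor_form_scaleC tensor_form_tensor mult.commute)
  then show ?thesis by (intro iffD1[OF tensor_form_inject] ext)
qed

instantiation tensor :: (fd_hilbert, fd_hilbert) fd_hilbert
begin

definition cinner_tensor :: "('a, 'b) tensor \<Rightarrow> ('a, 'b) tensor \<Rightarrow> complex" where
  "cinner_tensor s t = (\<Sum>e\<in>onb. \<Sum>f\<in>onb. cnj (tensor_form s e f) * tensor_form t e f)"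

instance
proof
  fix x y z :: "('a, 'b) tensor" and c :: complex
  show "cinner x y = cnj (cinner y x)"
    by (simp add: cinner_tensor_def mult.commute)
  show "cinner x (y + z) = cinner x y + cinner x z"
    by (simp add: cinner_tensor_def tensor_form_plus algebra_simps sum.distrib)
  show "cinner x (c *\<^sub>C y) = c * cinner x y"
    by (simp add: cinner_tensor_def tensor_form_scaleC algebra_simps sum_distrib_left)
  have re: "Re (cinner x x) = (\<Sum>e\<in>onb. \<Sum>f\<in>onb. (cmod (tensor_form x e f))\<^sup>2)"
    by (simp add: cinner_tensor_def cmod_power2) (simp add: power2_eq_square)
  show "0 < Re (cinner x x)" if "x \<noteq> 0"
  proof (rule ccontr)
    assume "\<not> 0 < Re (cinner x x)"
    moreover have "0 \<le> Re (cinner x x)" unfolding re by (intro sum_nonneg) auto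
    ultimately have "(\<Sum>e\<in>onb. \<Sum>f\<in>onb. (cmod (tensor_form x e f))\<^sup>2) = 0"
      using re by simp
    then have "\<forall>e\<in>onb. (\<Sum>f\<in>onb. (cmod (tensor_form x e f))\<^sup>2) = 0"
      by (subst (asm) sum_nonneg_eq_0_iff) (auto intro: sum_nonneg)
    then have "\<forall>e\<in>onb. \<forall>f\<in>onb. tensor_form x e f = 0"
      by (subst (asm) sum_nonneg_eq_0_iff) auto
    then have "x = 0" by (subst tensor_expand) simp
    then show False using that by simp
  qed
next
  let ?B = "(\<lambda>(e, f). e \<otimes> f) ` (onb \<times> onb) :: ('a, 'b) tensor set"
  have span: "t \<in> cvec.span ?B" for t
    by (subst tensor_expand) (intro cvec.span_sum cvec.span_scale cvec.span_base, auto)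
  have fin: "finite ?B" by simp
  have "\<forall>x. \<exists>c. x = (\<Sum>b\<in>?B. c b *\<^sub>C b)"
    using span unfolding cvec.span_finite[OF fin] by blast
  then show "\<exists>B :: ('a, 'b) tensor set. finite B \<and> (\<forall>x. \<exists>c. x = (\<Sum>b\<in>B. c b *\<^sub>C b))"
    using fin by blast
qed

end

lemma cinner_tensor: "cinner (x \<otimes> y) (x' \<otimes> y') = cinner x x' * cinner y y'"
proof -
  have "cinner (x \<otimes> y) (x' \<otimes> y')
      = (\<Sum>e\<in>onb. \<Sum>f\<in>onb. (cinner x e * cinner e x') * (cinner y f * cinner f y'))"
    by (simp add: cinner_tensor_def tensor_form_tensor ac_simps flip: cinner_commute)
  also have "\<dots> = cinner x x' * cinner y y'"
    by (simp only: sum_product[symmetric] parseval[OF is_onb_onb])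
  finally show ?thesis .
qed

text \<open>The linear map out of the tensor product induced by a bilinear map.\<close>

definition tlift :: "('a::fd_hilbert \<Rightarrow> 'b::fd_hilbert \<Rightarrow> 'c::complex_vector) \<Rightarrow> ('a, 'b) tensor \<Rightarrow> 'c"
  where "tlift \<beta> t = (\<Sum>e\<in>onb. \<Sum>f\<in>onb. tensor_form t e f *\<^sub>C \<beta> e f)"

lemma clinear_tlift: "clinear (tlift \<beta>)"
  unfolding clinear_iff tlift_def
  by (simp add: tensor_form_plus tensor_form_scaleC scaleC_add_left sum.distrib
      cvec.scale_sum_right scaleC_scaleC)

lemma tlift_tensor:
  assumes "\<And>y. clinear (\<lambda>x. \<beta> x y)" "\<And>x. clinear (\<beta> x)"
  shows "tlift \<beta> (x \<otimes> y) = \<beta> x y"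
proof -
  have "\<beta> x y = \<beta> (\<Sum>e\<in>onb. cinner e x *\<^sub>C e) y"
    by (simp add: onb_expand[OF is_onb_onb])
  also have "\<dots> = (\<Sum>e\<in>onb. cinner e x *\<^sub>C \<beta> e y)"
    by (simp add: clinear_sum[OF assms(1)] clinear_add_scaleC[OF assms(1)])
  also have "\<dots> = (\<Sum>e\<in>onb. cinner e x *\<^sub>C \<beta> e (\<Sum>f\<in>onb. cinner f y *\<^sub>C f))"
    by (simp add: onb_expand[OF is_onb_onb])
  also have "\<dots> = (\<Sum>e\<in>onb. \<Sum>f\<in>onb. (cinner e x * cinner f y) *\<^sub>C \<beta> e f)"
    by (simp only: clinear_sum[OF assms(2)] clinear_add_scaleC[OF assms(2)]
        cvec.scale_sum_right scaleC_scaleC)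
  finally show ?thesis by (simp add: tlift_def tensor_form_tensor)
qed

definition tensor_map :: "('a::fd_hilbert \<Rightarrow> 'c::fd_hilbert) \<Rightarrow> ('b::fd_hilbert \<Rightarrow> 'd::fd_hilbert)
    \<Rightarrow> ('a, 'b) tensor \<Rightarrow> ('c, 'd) tensor" (infixr \<open>\<otimes>\<^sub>l\<close> 72) where
  "f \<otimes>\<^sub>l g = tlift (\<lambda>x y. f x \<otimes> g y)"

definition tswap :: "('a::fd_hilbert, 'b::fd_hilbert) tensor \<Rightarrow> ('b, 'a) tensor" where
  "tswap = tlift (\<lambda>x y. y \<otimes> x)"

definition tassoc :: "(('a::fd_hilbert, 'b::fd_hilbert) tensor, 'c::fd_hilbert) tensor
    \<Rightarrow> ('a, ('b, 'c) tensor) tensor" where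
  "tassoc = tlift (\<lambda>t z. tlift (\<lambda>x y. x \<otimes> (y \<otimes> z)) t)"

definition tassoc_inv :: "('a::fd_hilbert, ('b::fd_hilbert, 'c::fd_hilbert) tensor) tensor
    \<Rightarrow> (('a, 'b) tensor, 'c) tensor" where
  "tassoc_inv = tlift (\<lambda>x t. tlift (\<lambda>y z. (x \<otimes> y) \<otimes> z) t)"

definition tlunit :: "(complex, 'a::fd_hilbert) tensor \<Rightarrow> 'a" where
  "tlunit = tlift (\<lambda>c x. c *\<^sub>C x)"

definition tlunit_inv :: "'a::fd_hilbert \<Rightarrow> (complex, 'a) tensor" where
  "tlunit_inv x = 1 \<otimes> x"

definition trunit :: "('a::fd_hilbert, complex) tensor \<Rightarrow> 'a" where
  "trunit = tlift (\<lambda>x c. c *\<^sub>C x)"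


section \<open>Quantum sets and quantum graphs\<close>

definition quantum_set :: "(('a::fd_hilbert, 'a) tensor \<Rightarrow> 'a) \<Rightarrow> (complex \<Rightarrow> 'a) \<Rightarrow> bool" where
  "quantum_set m u \<longleftrightarrow>
     clinear m \<and> clinear u \<and>
     m \<circ> (m \<otimes>\<^sub>l id) = m \<circ> (id \<otimes>\<^sub>l m) \<circ> tassoc \<and>
     m \<circ> (u \<otimes>\<^sub>l id) = tlunit \<and>
     m \<circ> (id \<otimes>\<^sub>l u) = trunit \<and>
     (m \<otimes>\<^sub>l id) \<circ> tassoc_inv \<circ> (id \<otimes>\<^sub>l m\<^sup>\<dagger>) = m\<^sup>\<dagger> \<circ> m \<and>
     m\<^sup>\<dagger> \<circ> m = (id \<otimes>\<^sub>l m) \<circ> tassoc \<circ> (m\<^sup>\<dagger> \<otimes>\<^sub>l id) \<and>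
     m \<circ> m\<^sup>\<dagger> = id \<and>
     u\<^sup>\<dagger> \<circ> m \<circ> tswap = u\<^sup>\<dagger> \<circ> m"

definition quantum_graph ::
  "(('a::fd_hilbert, 'a) tensor \<Rightarrow> 'a) \<Rightarrow> (complex \<Rightarrow> 'a) \<Rightarrow> ('a \<Rightarrow> 'a) \<Rightarrow> bool" where
  "quantum_graph m u G \<longleftrightarrow>
     quantum_set m u \<and> clinear G \<and> G\<^sup>\<dagger> = G \<and>
     m \<circ> (G \<otimes>\<^sub>l G) \<circ> m\<^sup>\<dagger> = G \<and>
     trunit \<circ> (id \<otimes>\<^sub>l (u\<^sup>\<dagger> \<circ> m)) \<circ> (id \<otimes>\<^sub>l (G \<otimes>\<^sub>l id)) \<circ> tassoc \<circ> ((m\<^sup>\<dagger> \<circ> u) \<otimes>\<^sub>l id) \<circ> tlunit_inv = G"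

definition reflexive_quantum_graph ::
  "(('a::fd_hilbert, 'a) tensor \<Rightarrow> 'a) \<Rightarrow> (complex \<Rightarrow> 'a) \<Rightarrow> ('a \<Rightarrow> 'a) \<Rightarrow> bool" where
  "reflexive_quantum_graph m u G \<longleftrightarrow> quantum_graph m u G \<and> m \<circ> (G \<otimes>\<^sub>l id) \<circ> m\<^sup>\<dagger> = id"


section \<open>The endomorphism algebra\<close>

typedef (overloaded) 'h endo = "{f :: 'h::fd_hilbert \<Rightarrow> 'h. clinear f}"
  morphisms endo_apply Abs_endo
  by (rule exI[of _ "\<lambda>_. 0"]) (simp add: clinear_iff)

setup_lifting type_definition_endo

instantiation endo :: (fd_hilbert) complex_vector
begin

lift_definition zero_endo :: "'a endo" is "\<lambda>_. 0" by (simp add: clinear_iff)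
lift_definition plus_endo :: "'a endo \<Rightarrow> 'a endo \<Rightarrow> 'a endo" is "\<lambda>f g x. f x + g x"
  by (simp add: clinear_iff scaleC_add_right)
lift_definition minus_endo :: "'a endo \<Rightarrow> 'a endo \<Rightarrow> 'a endo" is "\<lambda>f g x. f x - g x"
  by (simp add: clinear_iff cvec.scale_right_diff_distrib)
lift_definition uminus_endo :: "'a endo \<Rightarrow> 'a endo" is "\<lambda>f x. - f x"
  by (simp add: clinear_iff)
lift_definition scaleC_endo :: "complex \<Rightarrow> 'a endo \<Rightarrow> 'a endo" is "\<lambda>c f x. c *\<^sub>C f x"
  by (simp add: clinear_iff scaleC_add_right scaleC_scaleC mult.commute)

instance
  by standard (transfer; simp add: fun_eq_iff scaleC_add_right scaleC_add_left scaleC_scaleC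
      scaleC_one algebra_simps)+

end

lift_definition endo_id :: "'h::fd_hilbert endo" is "\<lambda>x. x" by (simp add: clinear_iff)

lift_definition endo_comp :: "'h::fd_hilbert endo \<Rightarrow> 'h endo \<Rightarrow> 'h endo" (infixl \<open>\<circ>\<^sub>E\<close> 70)
  is "\<lambda>f g x. f (g x)" by (simp add: clinear_iff)

lift_definition endo_adj :: "'h::fd_hilbert endo \<Rightarrow> 'h endo" is cadjoint
  by (rule clinear_cadjoint)

lift_definition endo_trace :: "'h::fd_hilbert endo \<Rightarrow> complex" is ctrace .

text \<open>The rank-one operator \<open>|x\<rangle>\<langle>y|\<close>.\<close>

lift_definition rank_one :: "'h::fd_hilbert \<Rightarrow> 'h \<Rightarrow> 'h endo" is "\<lambda>x y z. cinner y z *\<^sub>C x"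
  by (simp add: clinear_iff cinner_add_right cinner_scaleC_right scaleC_add_left scaleC_scaleC)

lemma endo_apply_plus: "endo_apply (f + g) x = endo_apply f x + endo_apply g x"
  and endo_apply_scaleC: "endo_apply (c *\<^sub>C f) x = c *\<^sub>C endo_apply f x"
  and endo_apply_zero: "endo_apply 0 x = 0"
  and endo_apply_comp: "endo_apply (f \<circ>\<^sub>E g) x = endo_apply f (endo_apply g x)"
  and endo_apply_rank_one: "endo_apply (rank_one v w) x = cinner w x *\<^sub>C v"
  by (transfer; simp)+

lemma endo_apply_sum: "endo_apply (\<Sum>i\<in>I. f i) x = (\<Sum>i\<in>I. endo_apply (f i) x)"
  by (induction I rule: infinite_finite_induct) (auto simp: endo_apply_plus endo_apply_zero)

lemma clinear_endo_apply: "clinear (endo_apply f)"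
  using endo_apply[of f] by simp

lemma endo_eqI: "(\<And>x. endo_apply f x = endo_apply g x) \<Longrightarrow> f = g"
  by (simp add: endo_apply_inject[symmetric] fun_eq_iff)

lemma endo_trace_adj_comp:
  "endo_trace (endo_adj x \<circ>\<^sub>E y) = (\<Sum>e\<in>onb. cinner (endo_apply x e) (endo_apply y e))"
  by transfer (simp add: ctrace_def cadjoint[symmetric])

lemma endo_expand:
  "f = (\<Sum>e\<in>onb. \<Sum>g\<in>onb. cinner g (endo_apply f e) *\<^sub>C rank_one g e)"
proof (rule endo_eqI)
  fix x
  have "endo_apply f x = endo_apply f (\<Sum>e\<in>onb. cinner e x *\<^sub>C e)"
    by (simp add: onb_expand[OF is_onb_onb])
  also have "\<dots> = (\<Sum>e\<in>onb. cinner e x *\<^sub>C endo_apply f e)"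
    by (simp add: clinear_sum[OF clinear_endo_apply] clinear_add_scaleC[OF clinear_endo_apply])
  also have "\<dots> = (\<Sum>e\<in>onb. cinner e x *\<^sub>C (\<Sum>g\<in>onb. cinner g (endo_apply f e) *\<^sub>C g))"
    by (simp add: onb_expand[OF is_onb_onb])
  finally show "endo_apply f x =
      endo_apply (\<Sum>e\<in>onb. \<Sum>g\<in>onb. cinner g (endo_apply f e) *\<^sub>C rank_one g e) x"
    by (simp add: endo_apply_sum endo_apply_scaleC endo_apply_rank_one cvec.scale_sum_right
        scaleC_scaleC mult.commute)
qed

lemma dim_pos_if_nonzero:
  assumes "x \<noteq> (0 :: 'a::fd_hilbert)"
  shows "0 < cvec.dim (UNIV :: 'a set)"
proof -
  obtain B :: "'a set" where B: "finite B" "cvec.span B = UNIV"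
    using finite_spanning by blast
  have "\<not> cvec.dependent {x}"
    using assms by (simp add: cvec.dependent_single)
  then obtain C where C: "{x} \<subseteq> C" "C \<subseteq> UNIV" "\<not> cvec.dependent C" "UNIV \<subseteq> cvec.span C"
    using cvec.maximal_independent_subset_extend[of "{x}" UNIV] by auto
  have "finite C"
    using cvec.independent_span_bound[OF B(1) C(3)] B(2) by auto
  moreover have "cvec.dim (UNIV :: 'a set) = card C"
    using C by (intro cvec.dim_unique) auto
  ultimately show ?thesis using C(1) by (auto simp: card_gt_0_iff)
qed

instantiation endo :: (fd_hilbert) fd_hilbert
begin

definition cinner_endo :: "'a endo \<Rightarrow> 'a endo \<Rightarrow> complex" where
  "cinner_endo x y = of_nat (cvec.dim (UNIV :: 'a set)) * endo_trace (endo_adj x \<circ>\<^sub>E y)"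

instance
proof
  fix x y z :: "'a endo" and c :: complex
  show "cinner x y = cnj (cinner y x)"
    by (simp add: cinner_endo_def endo_trace_adj_comp flip: cinner_commute)
  show "cinner x (y + z) = cinner x y + cinner x z"
    by (simp add: cinner_endo_def endo_trace_adj_comp endo_apply_plus cinner_add_right
        sum.distrib algebra_simps)
  show "cinner x (c *\<^sub>C y) = c * cinner x y"
    by (simp add: cinner_endo_def endo_trace_adj_comp endo_apply_scaleC cinner_scaleC_right
        sum_distrib_left algebra_simps)
  have nn: "0 \<le> Re (cinner v v)" for v :: 'a
    using cinner_pos[of v] by (cases "v = 0") auto
  show "0 < Re (cinner x x)" if "x \<noteq> 0"
  proof -
    have re: "Re (cinner x x) = real (cvec.dim (UNIV :: 'a set)) *
        (\<Sum>e\<in>onb. Re (cinner (endo_apply x e) (endo_apply x e)))"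
      by (simp add: cinner_endo_def endo_trace_adj_comp)
    have "\<exists>e\<in>onb. endo_apply x e \<noteq> 0"
    proof (rule ccontr)
      assume "\<not> ?thesis"
      then have "x = 0" by (subst endo_expand) simp
      then show False using that by simp
    qed
    then obtain e where e: "e \<in> onb" "endo_apply x e \<noteq> 0" by blast
    have "0 < (\<Sum>e\<in>onb. Re (cinner (endo_apply x e) (endo_apply x e)))"
      by (rule sum_pos2[OF finite_onb e(1)]) (use cinner_pos[OF e(2)] nn in auto)
    then show ?thesis unfolding re using dim_pos_if_nonzero[OF e(2)] by simp
  qed
next
  let ?B = "(\<lambda>(g, e). rank_one g e) ` (onb \<times> onb) :: 'a endo set"
  have span: "f \<in> cvec.span ?B" for f
    by (subst endo_expand) (intro cvec.span_sum cvec.span_scale cvec.span_base, auto)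
  have fin: "finite ?B" by simp
  have "\<forall>x. \<exists>c. x = (\<Sum>b\<in>?B. c b *\<^sub>C b)"
    using span unfolding cvec.span_finite[OF fin] by blast
  then show "\<exists>B :: 'a endo set. finite B \<and> (\<forall>x. \<exists>c. x = (\<Sum>b\<in>B. c b *\<^sub>C b))"
    using fin by blast
qed

end

definition endo_mult :: "('h::fd_hilbert endo, 'h endo) tensor \<Rightarrow> 'h endo" where
  "endo_mult = tlift (\<lambda>x y. x \<circ>\<^sub>E y)"

definition endo_unit :: "complex \<Rightarrow> 'h::fd_hilbert endo" where
  "endo_unit c = c *\<^sub>C endo_id"


section \<open>Operator systems and the correspondence\<close>

definition operator_system :: "'h::fd_hilbert endo set \<Rightarrow> bool" where
  "operator_system V \<longleftrightarrow> cvec.subspace V \<and> (\<forall>X\<in>V. endo_adj X \<in> V) \<and> endo_id \<in> V"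

text \<open>Bending one leg of \<open>G\<close> with \<open>\<Delta> u\<close> gives the element \<open>(G \<otimes> id) (\<Delta> (u 1))\<close> of
  \<open>End(H) \<otimes> End(H)\<close>. A tensor \<open>a \<otimes> b\<close> acts on \<open>End(H)\<close> by \<open>Y \<mapsto> a Y b\<close>; under this action the
  bent element becomes an operator on \<open>End(H)\<close>, which is an orthogonal projection when \<open>G\<close> is
  a quantum graph. (If \<open>G x = (\<Sum>i. a\<^sub>i x b\<^sub>i)\<close> it is \<open>Y \<mapsto> (1 / dim H) (\<Sum>i. Tr (b\<^sub>i Y) a\<^sub>i)\<close>.)
  The operator system associated with \<open>G\<close> is its range.\<close>

definition two_sided_action :: "('h::fd_hilbert endo, 'h endo) tensor \<Rightarrow> 'h endo \<Rightarrow> 'h endo" where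
  "two_sided_action t Y = tlift (\<lambda>a b. a \<circ>\<^sub>E Y \<circ>\<^sub>E b) t"

definition graph_projector :: "('h::fd_hilbert endo \<Rightarrow> 'h endo) \<Rightarrow> 'h endo \<Rightarrow> 'h endo" where
  "graph_projector G = two_sided_action ((G \<otimes>\<^sub>l id) (endo_mult\<^sup>\<dagger> (endo_unit 1)))"

definition graph_operator_space :: "('h::fd_hilbert endo \<Rightarrow> 'h endo) \<Rightarrow> 'h endo set" where
  "graph_operator_space G = range (graph_projector G)"

end

theory Submission
  imports Defs
begin

text \<open>Passing from \<open>G\<close> to its graph projector \<open>P\<close> permutes the indices of the matrix of \<open>G\<close>,
  \<open>\<langle>c, P(|a\<rangle>\<langle>b|) d\<rangle> = (1 / dim H) \<langle>c, G(|d\<rangle>\<langle>b|) a\<rangle>\<close>, so it is a bijection on linear maps.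
  It carries the product \<open>m (G \<otimes> G) m\<^sup>\<dagger>\<close> to the composition \<open>P P\<close>, and \<open>m (G \<otimes> id) m\<^sup>\<dagger>\<close> is left
  multiplication by \<open>P 1\<close>. Self-adjointness of \<open>G\<close> becomes compatibility of \<open>P\<close> with adjoints,
  and the two symmetry conditions on \<open>G\<close> together say that \<open>P\<close> is moreover self-adjoint.
  So the reflexive quantum graphs are exactly the orthogonal projections that commute with adjoints
  and fix \<open>1\<close>, which are determined by their ranges, the operator systems.\<close>

section \<open>Linear maps on tensor products\<close>

lemma clinear_id: "clinear (id :: 'a::complex_vector \<Rightarrow> 'a)"
  by (simp add: clinear_iff)

lemma clinear_comp:
  "clinear g \<Longrightarrow> clinear f \<Longrightarrow> clinear (g \<circ> f)"
  by (simp add: clinear_iff)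

lemma clinear_tensor_left: "clinear (\<lambda>x. x \<otimes> y)"
  by (simp add: clinear_iff tensor_add_left tensor_scaleC_left)

lemma clinear_tensor_right: "clinear ((\<otimes>) x)"
  by (simp add: clinear_iff tensor_add_right tensor_scaleC_right)

lemma clinear_tensor_map: "clinear (f \<otimes>\<^sub>l g)"
  unfolding tensor_map_def by (rule clinear_tlift)

lemma tensor_map_tensor:
  assumes "clinear f" "clinear g"
  shows "(f \<otimes>\<^sub>l g) (x \<otimes> y) = f x \<otimes> g y"
  unfolding tensor_map_def
  by (rule tlift_tensor)
    (use assms in \<open>simp_all add: clinear_iff tensor_add_left tensor_scaleC_left tensor_add_right
      tensor_scaleC_right\<close>)

text \<open>Elementary tensors span the tensor product, by \<open>tensor_expand\<close>. Every axiom
  of a quantum set that starts from a tensor product is reduced to them in this way.\<close>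

lemma clinear_tensor_eqI:
  assumes "clinear f" "clinear g" "\<And>x y. f (x \<otimes> y) = g (x \<otimes> y)"
  shows "f = g"
proof
  fix t
  show "f t = g t"
    by (subst (1 2) tensor_expand)
      (simp add: clinear_sum[OF assms(1)] clinear_sum[OF assms(2)]
        clinear_add_scaleC[OF assms(1)] clinear_add_scaleC[OF assms(2)] assms(3))
qed

lemma clinear_tassoc: "clinear tassoc"
  and clinear_tassoc_inv: "clinear tassoc_inv"
  and clinear_tlunit: "clinear tlunit"
  and clinear_trunit: "clinear trunit"
  and clinear_tswap: "clinear tswap"
  unfolding tassoc_def tassoc_inv_def tlunit_def trunit_def tswap_def by (rule clinear_tlift)+

text \<open>Linearity in a parameter of the lifted bilinear map; the nested lifts in
  \<open>tassoc\<close> and \<open>tassoc_inv\<close> need it for their outer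
  \<open>tlift_tensor\<close>.\<close>

lemma clinear_tlift_param:
  assumes "\<And>x y. clinear (\<lambda>z. \<beta> z x y)"
  shows "clinear (\<lambda>z. tlift (\<beta> z) t)"
  using assms by (simp add: clinear_iff tlift_def scaleC_add_right sum.distrib cvec.scale_sum_right
      scaleC_scaleC mult.commute)

lemma tassoc_tensor: "tassoc ((x \<otimes> y) \<otimes> z) = x \<otimes> (y \<otimes> z)"
proof -
  have "tassoc ((x \<otimes> y) \<otimes> z) = tlift (\<lambda>x y. x \<otimes> (y \<otimes> z)) (x \<otimes> y)"
    unfolding tassoc_def
    by (rule tlift_tensor, rule clinear_tlift, rule clinear_tlift_param)
      (simp add: clinear_iff tensor_add_right tensor_scaleC_right)
  also have "\<dots> = x \<otimes> (y \<otimes> z)"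
    by (rule tlift_tensor) (simp_all add: clinear_iff tensor_add_left tensor_scaleC_left
        tensor_add_right tensor_scaleC_right)
  finally show ?thesis .
qed

lemma tassoc_inv_tensor: "tassoc_inv (x \<otimes> (y \<otimes> z)) = (x \<otimes> y) \<otimes> z"
proof -
  have "tassoc_inv (x \<otimes> (y \<otimes> z)) = tlift (\<lambda>y z. (x \<otimes> y) \<otimes> z) (y \<otimes> z)"
    unfolding tassoc_inv_def
    by (rule tlift_tensor, rule clinear_tlift_param)
      (simp_all add: clinear_iff tensor_add_left tensor_scaleC_left clinear_tlift
        clinear_add_scaleC[OF clinear_tlift])
  also have "\<dots> = (x \<otimes> y) \<otimes> z"
    by (rule tlift_tensor) (simp_all add: clinear_iff tensor_add_left tensor_scaleC_left
        tensor_add_right tensor_scaleC_right)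
  finally show ?thesis .
qed

lemma tlunit_tensor: "tlunit (c \<otimes> x) = c *\<^sub>C x"
  and trunit_tensor: "trunit (x \<otimes> c) = c *\<^sub>C x"
  unfolding tlunit_def trunit_def
  by (rule tlift_tensor; simp add: clinear_iff scaleC_add_left scaleC_add_right scaleC_scaleC
      scaleC_complex_def mult.commute)+

lemma tswap_tensor: "tswap (x \<otimes> y) = y \<otimes> x"
  unfolding tswap_def
  by (rule tlift_tensor) (simp_all add: clinear_iff tensor_add_left tensor_scaleC_left
      tensor_add_right tensor_scaleC_right)

text \<open>A candidate for the adjoint need only be tested against elementary tensors in the first
  argument, because \<open>f\<close> is linear and these span. This is how the comultiplication is
  computed below.\<close>

lemma cadjoint_tensor_unique:
  assumes f: "clinear f" and fg: "\<And>x y z. cinner (f (x \<otimes> y)) z = cinner (x \<otimes> y) (g z)"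
  shows "f\<^sup>\<dagger> = g"
proof (rule cadjoint_unique)
  fix t z
  have "cinner (f t) z = (\<Sum>e\<in>onb. \<Sum>d\<in>onb. cnj (tensor_form t e d) * cinner (e \<otimes> d) (g z))"
    by (subst tensor_expand)
      (simp add: clinear_sum[OF f] clinear_add_scaleC[OF f] cinner_sum_left cinner_scaleC_left fg)
  also have "\<dots> = cinner t (g z)"
    by (subst (3) tensor_expand) (simp add: cinner_sum_left cinner_scaleC_left)
  finally show "cinner (f t) z = cinner t (g z)" .
qed

lemma cadjoint_eq_self_iff:
  assumes "clinear f"
  shows "f\<^sup>\<dagger> = f \<longleftrightarrow> (\<forall>x y. cinner (f x) y = cinner x (f y))"
  by (metis assms cadjoint cadjoint_unique)


section \<open>Orthogonal projections\<close>

text \<open>Pairing a vanishing combination of orthonormal vectors with one of them isolates its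
  coefficient, so \<open>onb\<close> is independent. The lemma identifies the count from a sum over
  \<open>onb\<close> with the dimension that weights the inner product.\<close>

lemma dim_eq_card_onb: "cvec.dim (UNIV :: 'a::fd_hilbert set) = card (onb :: 'a set)"
proof -
  have on: "orthonormal (onb :: 'a set)" "cvec.span (onb :: 'a set) = UNIV"
    using is_onb_onb unfolding is_onb_def by auto
  have "u e = 0" if "(\<Sum>v\<in>onb. u v *\<^sub>C v) = 0" "e \<in> onb" for u and e :: 'a
  proof -
    have "cinner e (\<Sum>v\<in>onb. u v *\<^sub>C v) = (\<Sum>v\<in>onb. if v = e then u e else 0)"
      using on that(2) unfolding cinner_sum_right cinner_scaleC_right
      by (intro sum.cong) (auto simp: orthonormal_def)
    then show ?thesis using that by simp
  qed
  then have "\<not> cvec.dependent (onb :: 'a set)"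
    unfolding cvec.dependent_finite[OF finite_onb] by blast
  then show ?thesis using on by (intro cvec.dim_unique) auto
qed

text \<open>A maximal independent subset of \<open>V\<close> is finite because the whole space is
  finitely spanned, so Gram-Schmidt yields an orthonormal basis \<open>C\<close> of
  \<open>V\<close>. The witness is the sum of the projections onto the lines spanned by the vectors
  of \<open>C\<close>.\<close>

lemma orthogonal_projection_exists:
  assumes "cvec.subspace (V :: 'a::fd_hilbert set)"
  obtains P where "clinear P" "P\<^sup>\<dagger> = P" "P \<circ> P = P" "range P = V"
proof -
  obtain B :: "'a set" where B: "finite B" "cvec.span B = UNIV"
    using finite_spanning by blast
  obtain D where D: "D \<subseteq> V" "\<not> cvec.dependent D" "V \<subseteq> cvec.span D"
    using cvec.maximal_independent_subset by metis
  have "finite D"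
    using cvec.independent_span_bound[OF B(1) D(2)] B(2) by auto
  moreover have "cvec.span D = V"
    using D assms by (metis cvec.span_minimal subset_antisym)
  ultimately obtain C where C: "finite C" "orthonormal C" "cvec.span C = V"
    using gram_schmidt by metis
  define P where "P = (\<lambda>x. \<Sum>e\<in>C. cinner e x *\<^sub>C e)"
  have lin: "clinear P"
    by (simp add: clinear_iff P_def cinner_add_right cinner_scaleC_right scaleC_add_left
        sum.distrib cvec.scale_sum_right scaleC_scaleC)
  have in_V: "P x \<in> V" for x
    unfolding P_def C(3)[symmetric] by (intro cvec.span_sum cvec.span_scale cvec.span_base)
  have fixes_V: "P x = x" if "x \<in> V" for x
    using that unfolding C(3)[symmetric]
  proof (induction rule: cvec.span_induct_alt)
    case base
    show ?case by (rule clinear_zero[OF lin])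
  next
    case (step c b y)
    have "P b = (\<Sum>e\<in>C. if e = b then b else 0)"
      unfolding P_def using C(2) step(1)
      by (intro sum.cong) (auto simp: orthonormal_def scaleC_one)
    then have "P b = b" using C(1) step(1) by simp
    then show ?case using step by (simp add: clinear_add_scaleC[OF lin])
  qed
  show ?thesis
  proof
    show "clinear P" by (rule lin)
    show "P\<^sup>\<dagger> = P"
      unfolding cadjoint_eq_self_iff[OF lin]
      by (simp add: P_def cinner_sum_left cinner_sum_right cinner_scaleC_left cinner_scaleC_right
          mult.commute flip: cinner_commute)
    show "P \<circ> P = P" using in_V fixes_V by auto
    show "range P = V" using in_V fixes_V by (metis image_subsetI rangeI subsetI subset_antisym)
  qed
qed

text \<open>An idempotent fixes its range, so equal ranges give P Q = Q and Q P = P. Taking adjoints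
  in the second equation turns it into P Q = P, hence P = Q.\<close>

lemma orthogonal_projection_unique:
  assumes "clinear P" "P\<^sup>\<dagger> = P" "P \<circ> P = P" "clinear Q" "Q\<^sup>\<dagger> = Q" "Q \<circ> Q = Q"
    and range: "range P = range Q"
  shows "P = Q"
proof
  fix y
  have PQ: "P (Q z) = Q z" for z
    using range assms(3) by (metis comp_apply imageE rangeI)
  have QP: "Q (P z) = P z" for z
    using range assms(6) by (metis comp_apply imageE rangeI)
  have "cinner x (P y) = cinner x (Q y)" for x
  proof -
    have "cinner x (P y) = cinner (Q (P x)) y"
      using assms(1,2) QP by (metis cadjoint)
    also have "\<dots> = cinner x (P (Q y))"
      using assms(1,2,4,5) by (metis cadjoint)
    finally show ?thesis using PQ by simp
  qed
  then show "P y = Q y" by (rule cinner_ext)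
qed


section \<open>The endomorphism algebra as a quantum set\<close>

abbreviation hdim :: "'h::fd_hilbert itself \<Rightarrow> complex" where
  "hdim _ \<equiv> of_nat (cvec.dim (UNIV :: 'h set))"

text \<open>For \<open>dim H = 0\<close> the scalar is \<open>0\<close>, but then every operator vanishes.\<close>

lemma hdim_inverse_cancel:
  fixes X :: "'h::fd_hilbert endo"
  shows "(hdim TYPE('h) * inverse (hdim TYPE('h))) *\<^sub>C X = X"
proof (cases "cvec.dim (UNIV :: 'h set) = 0")
  case True
  then have "(x :: 'h) = 0" for x using dim_pos_if_nonzero by force
  then have "X = 0" by (intro endo_eqI) metis
  then show ?thesis by simp
next
  case False
  then show ?thesis by (simp add: scaleC_one)
qed

text \<open>The same cancellation for inner products: a nonzero \<open>x\<close> forces positive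
  dimension, and for \<open>x = 0\<close> both sides vanish. Later arguments thereby need no case
  split on the dimension.\<close>

lemma hdim_inverse_cancel_cinner:
  fixes x y :: "'h::fd_hilbert"
  shows "hdim TYPE('h) * (inverse (hdim TYPE('h)) * cinner x y) = cinner x y"
  using dim_pos_if_nonzero[of x] by (cases "x = 0") auto

lemma hdim_cancel_iff:
  fixes x y z w :: "'h::fd_hilbert"
  shows "hdim TYPE('h) * cinner x y = hdim TYPE('h) * cinner z w \<longleftrightarrow> cinner x y = cinner z w"
  using hdim_inverse_cancel_cinner[of x y] hdim_inverse_cancel_cinner[of z w]
  by (metis mult.left_commute)

section \<open>Products, adjoints, trace and rank-one operators\<close>

lemma endo_comp_assoc: "(x \<circ>\<^sub>E y) \<circ>\<^sub>E z = x \<circ>\<^sub>E (y \<circ>\<^sub>E z)"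
  by (rule endo_eqI) (simp add: endo_apply_comp)

lemma endo_apply_id: "endo_apply endo_id x = x"
  by transfer simp

lemma endo_id_left [simp]: "endo_id \<circ>\<^sub>E x = x"
  and endo_id_right [simp]: "x \<circ>\<^sub>E endo_id = x"
  by (rule endo_eqI, simp add: endo_apply_comp endo_apply_id)+

lemma clinear_endo_comp_left: "clinear (\<lambda>x. x \<circ>\<^sub>E y)"
  by (auto simp: clinear_iff endo_apply_comp endo_apply_plus endo_apply_scaleC intro!: endo_eqI)

lemma clinear_endo_comp_right: "clinear ((\<circ>\<^sub>E) x)"
  by (auto simp: clinear_iff endo_apply_comp endo_apply_plus endo_apply_scaleC
      clinear_add_scaleC[OF clinear_endo_apply] intro!: endo_eqI)

lemmas endo_comp_linear =
  clinear_sum[OF clinear_endo_comp_left] clinear_sum[OF clinear_endo_comp_right]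
  clinear_add_scaleC[OF clinear_endo_comp_left] clinear_add_scaleC[OF clinear_endo_comp_right]

lemma cinner_endo_adj: "cinner (endo_apply x v) w = cinner v (endo_apply (endo_adj x) w)"
  by transfer (rule cadjoint)

lemma endo_eq_cinnerI:
  "(\<And>v w. cinner v (endo_apply x w) = cinner v (endo_apply y w)) \<Longrightarrow> x = y"
  by (rule endo_eqI, rule cinner_ext) blast

lemma cinner_endo_adj_right: "cinner v (endo_apply (endo_adj x) w) = cnj (cinner w (endo_apply x v))"
  by (simp flip: cinner_endo_adj cinner_commute)

lemma endo_adj_adj [simp]: "endo_adj (endo_adj x) = x"
  by (rule endo_eq_cinnerI) (simp add: cinner_endo_adj_right)

lemma endo_adj_comp: "endo_adj (x \<circ>\<^sub>E y) = endo_adj y \<circ>\<^sub>E endo_adj x"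
  by (rule endo_eq_cinnerI) (simp add: endo_apply_comp flip: cinner_endo_adj)

lemma endo_adj_id [simp]: "endo_adj endo_id = endo_id"
  by (rule endo_eq_cinnerI) (simp add: endo_apply_id flip: cinner_endo_adj)

lemma endo_adj_add: "endo_adj (x + y) = endo_adj x + endo_adj y"
  by (rule endo_eq_cinnerI)
    (simp add: cinner_endo_adj_right endo_apply_plus cinner_add_right)

lemma endo_adj_scaleC: "endo_adj (c *\<^sub>C x) = cnj c *\<^sub>C endo_adj x"
  by (rule endo_eq_cinnerI)
    (simp add: cinner_endo_adj_right endo_apply_scaleC cinner_scaleC_right)

lemma endo_adj_rank_one [simp]: "endo_adj (rank_one v w) = rank_one w v"
  by (rule endo_eq_cinnerI)
    (simp add: cinner_endo_adj_right endo_apply_rank_one cinner_scaleC_right mult.commute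
      flip: cinner_commute)

text \<open>Parseval inserts a second sum over the basis. The result is symmetric under exchanging
  the two factors and the two sums, which makes the trace cyclic.\<close>

lemma endo_trace_comp:
  "endo_trace (x \<circ>\<^sub>E y)
    = (\<Sum>e\<in>onb. \<Sum>f\<in>onb. cinner e (endo_apply x f) * cinner f (endo_apply y e))"
proof -
  have "endo_trace (x \<circ>\<^sub>E y) = (\<Sum>e\<in>onb. cinner (endo_apply (endo_adj x) e) (endo_apply y e))"
    using endo_trace_adj_comp[of "endo_adj x" y] by simp
  also have "\<dots> = (\<Sum>e\<in>onb. \<Sum>f\<in>onb.
      cinner (endo_apply (endo_adj x) e) f * cinner f (endo_apply y e))"
    by (simp add: parseval[OF is_onb_onb])
  finally show ?thesis by (simp add: cinner_endo_adj)
qed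

lemma endo_trace_comm: "endo_trace (x \<circ>\<^sub>E y) = endo_trace (y \<circ>\<^sub>E x)"
  unfolding endo_trace_comp by (subst sum.swap) (simp add: mult.commute)

lemma cinner_endo_id_left: "cinner (endo_id :: 'h::fd_hilbert endo) x = hdim TYPE('h) * endo_trace x"
  by (simp add: cinner_endo_def)

lemma cinner_endo_comp_left: "cinner (x \<circ>\<^sub>E y) z = cinner y (endo_adj x \<circ>\<^sub>E z)"
  by (simp add: cinner_endo_def endo_adj_comp endo_comp_assoc)

lemma cinner_endo_comp_right: "cinner (x \<circ>\<^sub>E y) z = cinner x (z \<circ>\<^sub>E endo_adj y)"
  using endo_trace_comm[of "endo_adj y" "endo_adj x \<circ>\<^sub>E z"]
  by (simp add: cinner_endo_def endo_adj_comp endo_comp_assoc)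

lemma cinner_endo_adj_adj: "cinner (endo_adj x) (endo_adj y) = cinner y x"
  by (simp add: cinner_endo_def endo_trace_comm)

text \<open>Pairing with a rank-one operator reads off a matrix entry, up to the weight dim H of the
  inner product. Conditions on maps of operators become conditions on entries through this
  identity.\<close>

lemma cinner_rank_one_left:
  fixes v w :: "'h::fd_hilbert"
  shows "cinner (rank_one v w) x = hdim TYPE('h) * cinner v (endo_apply x w)"
proof -
  have "(\<Sum>e\<in>onb. cinner (cinner w e *\<^sub>C v) (endo_apply x e))
      = cinner v (endo_apply x (\<Sum>e\<in>onb. cinner e w *\<^sub>C e))"
    by (simp add: clinear_sum[OF clinear_endo_apply] clinear_add_scaleC[OF clinear_endo_apply]
        cinner_sum_right cinner_scaleC_right cinner_scaleC_left flip: cinner_commute)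
  then show ?thesis
    by (simp add: cinner_endo_def endo_trace_adj_comp endo_apply_rank_one
        onb_expand[OF is_onb_onb] del: endo_adj_rank_one)
qed

lemma endo_trace_rank_one_comp: "endo_trace (x \<circ>\<^sub>E rank_one v w) = cinner w (endo_apply x v)"
proof -
  have "endo_trace (x \<circ>\<^sub>E rank_one v w) = endo_trace (endo_adj (rank_one w v) \<circ>\<^sub>E x)"
    by (simp add: endo_trace_comm)
  also have "\<dots> = (\<Sum>e\<in>onb. cinner (endo_apply (rank_one w v) e) (endo_apply x e))"
    by (simp add: endo_trace_adj_comp del: endo_adj_rank_one)
  also have "\<dots> = cinner w (endo_apply x (\<Sum>e\<in>onb. cinner e v *\<^sub>C e))"
    by (simp add: clinear_sum[OF clinear_endo_apply] clinear_add_scaleC[OF clinear_endo_apply]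
        cinner_sum_right cinner_scaleC_right cinner_scaleC_left endo_apply_rank_one
        flip: cinner_commute)
  finally show ?thesis by (simp add: onb_expand[OF is_onb_onb])
qed

section \<open>Multiplication, unit and their adjoints\<close>

lemma clinear_endo_mult: "clinear endo_mult"
  unfolding endo_mult_def by (rule clinear_tlift)

lemma endo_mult_tensor [simp]: "endo_mult (x \<otimes> y) = x \<circ>\<^sub>E y"
  unfolding endo_mult_def
  by (rule tlift_tensor[OF clinear_endo_comp_left clinear_endo_comp_right])

lemma clinear_endo_unit: "clinear endo_unit"
  by (simp add: clinear_iff endo_unit_def scaleC_add_left scaleC_scaleC scaleC_complex_def)

lemma endo_unit_adjoint:
  "endo_unit\<^sup>\<dagger> (x :: 'h::fd_hilbert endo) = hdim TYPE('h) * endo_trace x"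
  by (rule fun_cong[OF cadjoint_unique])
    (simp add: endo_unit_def cinner_scaleC_left cinner_endo_id_left cinner_complex_def)

text \<open>Tested against a tensor of \<open>a\<close> and \<open>b\<close>, the first leg extracts
  the matrix entries of \<open>a\<close> and the second uses them to rebuild the product of
  \<open>a\<close> and \<open>b\<close>. The factor 1 / dim H compensates the surplus weight: two
  inner products of operators appear on one side and only one on the other.\<close>

lemma endo_mult_adjoint:
  "endo_mult\<^sup>\<dagger> (x :: 'h::fd_hilbert endo) = inverse (hdim TYPE('h)) *\<^sub>C
    (\<Sum>i\<in>onb. \<Sum>k\<in>onb. rank_one i k \<otimes> (rank_one k i \<circ>\<^sub>E x))"
proof -
  have "cinner (endo_mult (a \<otimes> b)) x = cinner (a \<otimes> b) (inverse (hdim TYPE('h)) *\<^sub>C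
    (\<Sum>i\<in>onb. \<Sum>k\<in>onb. rank_one i k \<otimes> (rank_one k i \<circ>\<^sub>E x)))" for a b x :: "'h endo"
  proof -
    have "cinner (a \<otimes> b) (\<Sum>i\<in>onb. \<Sum>k\<in>onb. rank_one i k \<otimes> (rank_one k i \<circ>\<^sub>E x))
      = (\<Sum>i\<in>onb. \<Sum>k\<in>onb. cinner a (rank_one i k) * cinner b (rank_one k i \<circ>\<^sub>E x))"
      by (simp add: cinner_sum_right cinner_tensor)
    also have "\<dots> = (\<Sum>k\<in>onb. \<Sum>i\<in>onb. cinner a (rank_one i k) * cinner b (rank_one k i \<circ>\<^sub>E x))"
      by (rule sum.swap)
    also have "\<dots> = (\<Sum>k\<in>onb. \<Sum>i\<in>onb. hdim TYPE('h) *
        (cnj (cinner i (endo_apply a k)) * cinner (rank_one i k \<circ>\<^sub>E b) x))"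
      by (subst cinner_commute) (simp add: cinner_rank_one_left cinner_endo_comp_left ac_simps)
    also have "\<dots> = hdim TYPE('h) * cinner ((\<Sum>k\<in>onb. \<Sum>i\<in>onb.
        cinner i (endo_apply a k) *\<^sub>C rank_one i k) \<circ>\<^sub>E b) x"
      by (simp add: endo_comp_linear cinner_sum_left cinner_scaleC_left sum_distrib_left)
    also have "\<dots> = hdim TYPE('h) * cinner (a \<circ>\<^sub>E b) x"
      by (simp flip: endo_expand)
    \<comment> \<open>The scalar dim H times its inverse is kept as a product acting on
      \<open>x\<close>, since \<open>hdim_inverse_cancel\<close> removes it even when dim H =
      0.\<close>
    finally have "cinner (a \<otimes> b) (inverse (hdim TYPE('h)) *\<^sub>C
      (\<Sum>i\<in>onb. \<Sum>k\<in>onb. rank_one i k \<otimes> (rank_one k i \<circ>\<^sub>E x)))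
      = cinner (a \<circ>\<^sub>E b) ((hdim TYPE('h) * inverse (hdim TYPE('h))) *\<^sub>C x)"
      by (simp add: cinner_scaleC_right)
    then show ?thesis by (simp only: hdim_inverse_cancel endo_mult_tensor)
  qed
  from cadjoint_tensor_unique[OF clinear_endo_mult this] show ?thesis by simp
qed

text \<open>The mirror image, obtained by expanding \<open>b\<close> instead of \<open>a\<close>,
  with \<open>x\<close> multiplied from the left on the first leg. Each Frobenius equation becomes
  immediate from one of the two forms: this one suits multiplication from the left, the other
  multiplication from the right.\<close>

lemma endo_mult_adjoint':
  "endo_mult\<^sup>\<dagger> (x :: 'h::fd_hilbert endo) = inverse (hdim TYPE('h)) *\<^sub>C
    (\<Sum>i\<in>onb. \<Sum>k\<in>onb. (x \<circ>\<^sub>E rank_one i k) \<otimes> rank_one k i)"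
proof -
  have "cinner (endo_mult (a \<otimes> b)) x = cinner (a \<otimes> b) (inverse (hdim TYPE('h)) *\<^sub>C
    (\<Sum>i\<in>onb. \<Sum>k\<in>onb. (x \<circ>\<^sub>E rank_one i k) \<otimes> rank_one k i))" for a b x :: "'h endo"
  proof -
    have "cinner (a \<otimes> b) (\<Sum>i\<in>onb. \<Sum>k\<in>onb. (x \<circ>\<^sub>E rank_one i k) \<otimes> rank_one k i)
      = (\<Sum>i\<in>onb. \<Sum>k\<in>onb. cinner b (rank_one k i) * cinner a (x \<circ>\<^sub>E rank_one i k))"
      by (simp add: cinner_sum_right cinner_tensor mult.commute)
    also have "\<dots> = (\<Sum>i\<in>onb. \<Sum>k\<in>onb. hdim TYPE('h) *
        (cnj (cinner k (endo_apply b i)) * cinner (a \<circ>\<^sub>E rank_one k i) x))"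
      by (subst cinner_commute) (simp add: cinner_rank_one_left cinner_endo_comp_right ac_simps)
    also have "\<dots> = hdim TYPE('h) * cinner (a \<circ>\<^sub>E (\<Sum>i\<in>onb. \<Sum>k\<in>onb.
        cinner k (endo_apply b i) *\<^sub>C rank_one k i)) x"
      by (simp add: endo_comp_linear cinner_sum_left cinner_scaleC_left sum_distrib_left)
    also have "\<dots> = hdim TYPE('h) * cinner (a \<circ>\<^sub>E b) x"
      by (simp flip: endo_expand)
    finally have "cinner (a \<otimes> b) (inverse (hdim TYPE('h)) *\<^sub>C
      (\<Sum>i\<in>onb. \<Sum>k\<in>onb. (x \<circ>\<^sub>E rank_one i k) \<otimes> rank_one k i))
      = cinner (a \<circ>\<^sub>E b) ((hdim TYPE('h) * inverse (hdim TYPE('h))) *\<^sub>C x)"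
      by (simp add: cinner_scaleC_right)
    then show ?thesis by (simp only: hdim_inverse_cancel endo_mult_tensor)
  qed
  from cadjoint_tensor_unique[OF clinear_endo_mult this] show ?thesis by simp
qed

lemma clinear_endo_mult_adjoint: "clinear (endo_mult\<^sup>\<dagger>)"
  by (rule clinear_cadjoint[OF clinear_endo_mult])

lemma rank_one_resolution: "(\<Sum>k\<in>onb. rank_one k k) = endo_id"
  by (rule endo_eqI)
    (simp add: endo_apply_sum endo_apply_rank_one endo_apply_id onb_expand[OF is_onb_onb])

lemma rank_one_comp: "rank_one v w \<circ>\<^sub>E rank_one v' w' = cinner w v' *\<^sub>C rank_one v w'"
  by (rule endo_eqI)
    (simp add: endo_apply_comp endo_apply_rank_one endo_apply_scaleC scaleC_scaleC
      clinear_add_scaleC[OF clinear_endo_apply] mult.commute)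

lemma rank_one_comp_onb:
  assumes "k \<in> onb"
  shows "rank_one i k \<circ>\<^sub>E rank_one k j = rank_one i j"
proof -
  have "cinner k k = 1" using assms is_onb_onb unfolding is_onb_def orthonormal_def by auto
  then show ?thesis by (simp add: rank_one_comp scaleC_one)
qed

lemma tensor_map_endo_mult_adjoint:
  assumes "clinear f" "clinear g"
  shows "(f \<otimes>\<^sub>l g) (endo_mult\<^sup>\<dagger> (x :: 'h::fd_hilbert endo)) = inverse (hdim TYPE('h)) *\<^sub>C
    (\<Sum>i\<in>onb. \<Sum>k\<in>onb. f (rank_one i k) \<otimes> g (rank_one k i \<circ>\<^sub>E x))"
  unfolding endo_mult_adjoint
  by (simp add: clinear_sum[OF clinear_tensor_map] clinear_add_scaleC[OF clinear_tensor_map]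
      tensor_map_tensor[OF assms])

lemma quantum_set_endo: "quantum_set endo_mult (endo_unit :: complex \<Rightarrow> 'h::fd_hilbert endo)"
  unfolding quantum_set_def
proof (intro conjI)
  note lin = clinear_comp clinear_endo_mult clinear_endo_unit clinear_tensor_map clinear_tassoc
    clinear_tassoc_inv clinear_endo_mult_adjoint clinear_tlunit clinear_trunit clinear_tswap
    clinear_id clinear_cadjoint
  let ?m = "endo_mult :: ('h endo, 'h endo) tensor \<Rightarrow> _"
  let ?u = "endo_unit :: complex \<Rightarrow> 'h endo"
  show "clinear ?m" "clinear ?u" by (rule lin)+
  have "(?m \<circ> (?m \<otimes>\<^sub>l id)) (t \<otimes> z) = (?m \<circ> (id \<otimes>\<^sub>l ?m) \<circ> tassoc) (t \<otimes> z)" for t z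
  proof -
    \<comment> \<open>Three factors need two reductions to elementary tensors: with \<open>z\<close>
      fixed, both sides are linear in \<open>t\<close>, so \<open>t\<close> may be taken elementary
      as well.\<close>
    have "?m \<circ> (?m \<otimes>\<^sub>l id) \<circ> (\<lambda>t. t \<otimes> z) = ?m \<circ> (id \<otimes>\<^sub>l ?m) \<circ> tassoc \<circ> (\<lambda>t. t \<otimes> z)"
      by (rule clinear_tensor_eqI)
        (simp_all add: lin clinear_tensor_left tassoc_tensor tensor_map_tensor endo_comp_assoc)
    then show ?thesis by (simp add: fun_eq_iff)
  qed
  then show "?m \<circ> (?m \<otimes>\<^sub>l id) = ?m \<circ> (id \<otimes>\<^sub>l ?m) \<circ> tassoc"
    by (intro clinear_tensor_eqI) (simp_all add: lin)
  show "?m \<circ> (?u \<otimes>\<^sub>l id) = tlunit"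
    by (rule clinear_tensor_eqI)
      (simp_all add: lin tensor_map_tensor tlunit_tensor endo_unit_def endo_comp_linear)
  show "?m \<circ> (id \<otimes>\<^sub>l ?u) = trunit"
    by (rule clinear_tensor_eqI)
      (simp_all add: lin tensor_map_tensor trunit_tensor endo_unit_def endo_comp_linear)
  show "(?m \<otimes>\<^sub>l id) \<circ> tassoc_inv \<circ> (id \<otimes>\<^sub>l ?m\<^sup>\<dagger>) = ?m\<^sup>\<dagger> \<circ> ?m"
    by (rule clinear_tensor_eqI)
      (simp_all add: lin tensor_map_tensor endo_mult_adjoint' tassoc_inv_tensor
        clinear_sum[OF clinear_tensor_right] clinear_add_scaleC[OF clinear_tensor_right]
        clinear_sum[OF clinear_tassoc_inv] clinear_add_scaleC[OF clinear_tassoc_inv]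
        clinear_sum[OF clinear_tensor_map] clinear_add_scaleC[OF clinear_tensor_map]
        endo_comp_assoc)
  show "?m\<^sup>\<dagger> \<circ> ?m = (id \<otimes>\<^sub>l ?m) \<circ> tassoc \<circ> (?m\<^sup>\<dagger> \<otimes>\<^sub>l id)"
    by (rule clinear_tensor_eqI)
      (simp_all add: lin tensor_map_tensor endo_mult_adjoint tassoc_tensor
        clinear_sum[OF clinear_tensor_left] clinear_add_scaleC[OF clinear_tensor_left]
        clinear_sum[OF clinear_tassoc] clinear_add_scaleC[OF clinear_tassoc]
        clinear_sum[OF clinear_tensor_map] clinear_add_scaleC[OF clinear_tensor_map]
        endo_comp_assoc)
  show "?m \<circ> ?m\<^sup>\<dagger> = id"
  proof
    fix x :: "'h endo"
    \<comment> \<open>The product of the two matrix units does not depend on \<open>k\<close>, so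
      the sum over \<open>k\<close> contributes the factor dim H that the 1 / dim H in the
      comultiplication cancels; the diagonal units add up to the identity.\<close>
    have "(\<Sum>i\<in>onb. \<Sum>k\<in>onb. rank_one i k \<circ>\<^sub>E (rank_one k i \<circ>\<^sub>E x))
      = (\<Sum>i\<in>onb. \<Sum>k\<in>(onb :: 'h set). rank_one i i \<circ>\<^sub>E x)"
      by (intro sum.cong refl) (simp add: rank_one_comp_onb flip: endo_comp_assoc)
    also have "\<dots> = (\<Sum>k\<in>(onb :: 'h set). (\<Sum>i\<in>onb. rank_one i i) \<circ>\<^sub>E x)"
      by (subst sum.swap) (simp add: endo_comp_linear)
    also have "\<dots> = hdim TYPE('h) *\<^sub>C x"
      by (simp add: rank_one_resolution cvec.sum_constant_scale dim_eq_card_onb)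
    finally show "(?m \<circ> ?m\<^sup>\<dagger>) x = id x"
      using hdim_inverse_cancel[of x]
      by (simp add: endo_mult_adjoint clinear_sum[OF clinear_endo_mult]
          clinear_add_scaleC[OF clinear_endo_mult] scaleC_scaleC mult.commute)
  qed
  show "?u\<^sup>\<dagger> \<circ> ?m \<circ> tswap = ?u\<^sup>\<dagger> \<circ> ?m"
  proof (rule clinear_tensor_eqI)
    show "(?u\<^sup>\<dagger> \<circ> ?m \<circ> tswap) (x \<otimes> y) = (?u\<^sup>\<dagger> \<circ> ?m) (x \<otimes> y)" for x y
      by (simp add: tswap_tensor endo_unit_adjoint endo_trace_comm)
  qed (simp_all add: lin)
qed


section \<open>The graph projector\<close>

lemma graph_projector_eq:
  fixes G :: "'h::fd_hilbert endo \<Rightarrow> 'h endo"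
  assumes "clinear G"
  shows "graph_projector G Y = inverse (hdim TYPE('h)) *\<^sub>C
    (\<Sum>i\<in>onb. \<Sum>k\<in>onb. G (rank_one i k) \<circ>\<^sub>E Y \<circ>\<^sub>E rank_one k i)"
proof -
  have "tlift (\<lambda>a b. a \<circ>\<^sub>E Y \<circ>\<^sub>E b) (x \<otimes> y) = x \<circ>\<^sub>E Y \<circ>\<^sub>E y" for x y
    by (rule tlift_tensor) (simp_all add: clinear_iff endo_comp_linear)
  then show ?thesis
    by (simp add: graph_projector_def two_sided_action_def endo_unit_def scaleC_one
        tensor_map_endo_mult_adjoint[OF assms clinear_id] clinear_sum[OF clinear_tlift]
        clinear_add_scaleC[OF clinear_tlift])
qed

lemma clinear_graph_projector: "clinear G \<Longrightarrow> clinear (graph_projector G)"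
  by (simp add: clinear_iff[of "graph_projector G"] graph_projector_eq endo_comp_linear
      sum.distrib scaleC_add_right scaleC_scaleC mult.commute flip: cvec.scale_sum_right)

section \<open>Matrix entries of the graph projector\<close>

lemma rank_one_expand:
  "rank_one v w = (\<Sum>i\<in>onb. \<Sum>k\<in>onb. (cinner i v * cinner w k) *\<^sub>C rank_one i k)"
  by (subst endo_expand, subst sum.swap)
    (simp add: endo_apply_rank_one cinner_scaleC_right mult.commute)

lemma rank_one_expand_left: "rank_one v w = (\<Sum>i\<in>onb. cinner i v *\<^sub>C rank_one i w)"
proof (rule endo_eqI)
  fix x
  have "endo_apply (rank_one v w) x = cinner w x *\<^sub>C (\<Sum>i\<in>onb. cinner i v *\<^sub>C i)"
    by (simp add: endo_apply_rank_one onb_expand[OF is_onb_onb])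
  then show "endo_apply (rank_one v w) x = endo_apply (\<Sum>i\<in>onb. cinner i v *\<^sub>C rank_one i w) x"
    by (simp add: endo_apply_sum endo_apply_scaleC endo_apply_rank_one cvec.scale_sum_right
        scaleC_scaleC mult.commute)
qed

text \<open>Here \<open>Y\<close> is arbitrary, so only the sum over \<open>i\<close> can be
  absorbed, into the vector \<open>d\<close>. This form serves to compose the projector with
  itself.\<close>

lemma graph_projector_entry_onb:
  fixes d :: "'h::fd_hilbert"
  assumes G: "clinear G"
  shows "cinner c (endo_apply (graph_projector G Y) d) = inverse (hdim TYPE('h)) *
    (\<Sum>k\<in>onb. cinner c (endo_apply (G (rank_one d k)) (endo_apply Y k)))"
proof -
  have "(\<Sum>k\<in>onb. cinner c (endo_apply (G (rank_one d k)) (endo_apply Y k)))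
    = (\<Sum>k\<in>onb. \<Sum>i\<in>onb. cinner i d * cinner c (endo_apply (G (rank_one i k)) (endo_apply Y k)))"
    by (subst rank_one_expand_left[of d])
      (simp add: clinear_sum[OF G] clinear_add_scaleC[OF G] endo_apply_sum endo_apply_scaleC
        cinner_sum_right cinner_scaleC_right)
  also have "\<dots>
    = (\<Sum>i\<in>onb. \<Sum>k\<in>onb. cinner i d * cinner c (endo_apply (G (rank_one i k)) (endo_apply Y k)))"
    by (rule sum.swap)
  finally show ?thesis
    by (simp add: graph_projector_eq[OF G] endo_apply_sum endo_apply_scaleC endo_apply_comp
        endo_apply_rank_one clinear_add_scaleC[OF clinear_endo_apply] cinner_sum_right
        cinner_scaleC_right)
qed

text \<open>For rank-one arguments both sums of \<open>graph_projector_eq\<close> collapse. What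
  remains is the exchange of the indices \<open>a\<close> and \<open>d\<close>, together with a
  factor 1 / dim H.\<close>

lemma graph_projector_entry:
  fixes a b c d :: "'h::fd_hilbert"
  assumes G: "clinear G"
  shows "cinner c (endo_apply (graph_projector G (rank_one a b)) d)
    = inverse (hdim TYPE('h)) * cinner c (endo_apply (G (rank_one d b)) a)"
proof -
  have "cinner c (endo_apply (G (rank_one d b)) a)
    = (\<Sum>i\<in>onb. \<Sum>k\<in>onb. cinner i d * cinner b k * cinner c (endo_apply (G (rank_one i k)) a))"
    by (subst rank_one_expand)
      (simp add: clinear_sum[OF G] clinear_add_scaleC[OF G] endo_apply_sum endo_apply_scaleC
        cinner_sum_right cinner_scaleC_right)
  then show ?thesis
    by (simp add: graph_projector_eq[OF G] endo_apply_sum endo_apply_scaleC endo_apply_comp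
        endo_apply_rank_one clinear_add_scaleC[OF clinear_endo_apply] cinner_sum_right
        cinner_scaleC_right sum_distrib_left ac_simps)
qed

lemma graph_projector_entry':
  fixes a b c d :: "'h::fd_hilbert"
  assumes G: "clinear G"
  shows "cinner c (endo_apply (G (rank_one d b)) a)
    = hdim TYPE('h) * cinner c (endo_apply (graph_projector G (rank_one a b)) d)"
  unfolding graph_projector_entry[OF G] by (rule hdim_inverse_cancel_cinner[symmetric])

lemma clinear_endo_eqI:
  assumes F: "clinear F" and G: "clinear G" and eq: "\<And>v w. F (rank_one v w) = G (rank_one v w)"
  shows "F = G"
proof
  fix x
  show "F x = G x"
    by (subst (1 2) endo_expand)
      (simp add: clinear_sum[OF F] clinear_sum[OF G] clinear_add_scaleC[OF F]
        clinear_add_scaleC[OF G] eq)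
qed

lemma clinear_endo_entry_eqI:
  assumes "clinear F" "clinear G"
    "\<And>a b c d. cinner c (endo_apply (F (rank_one a b)) d) = cinner c (endo_apply (G (rank_one a b)) d)"
  shows "F = G"
  by (rule clinear_endo_eqI[OF assms(1,2)], rule endo_eq_cinnerI) (rule assms(3))

lemma clinear_endo_eq_iff_entry:
  assumes "clinear F" "clinear G"
  shows "F = G \<longleftrightarrow> (\<forall>a b c d. cinner c (endo_apply (F (rank_one a b)) d)
    = cinner c (endo_apply (G (rank_one a b)) d))"
  using clinear_endo_entry_eqI[OF assms] by blast

text \<open>The exchange of indices can be undone, by \<open>graph_projector_entry'\<close>, so the
  projector determines every entry of the map.\<close>

lemma graph_projector_inject:
  assumes "clinear F" "clinear G" "graph_projector F = graph_projector G"
  shows "F = G"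
  using assms by (intro clinear_endo_entry_eqI) (simp_all add: graph_projector_entry')

lemma graph_projector_surj:
  fixes P :: "'h::fd_hilbert endo \<Rightarrow> 'h endo"
  assumes P: "clinear P"
  obtains G where "clinear G" "graph_projector G = P"
proof
  let ?n = "hdim TYPE('h)"
  \<comment> \<open>Exchanging the same two indices twice is the identity, and each application of
    \<open>graph_projector\<close> divides by the dimension. Hence the preimage of \<open>P\<close>
    is its own graph projector rescaled by the square of the dimension.\<close>
  let ?G = "\<lambda>x. (?n * ?n) *\<^sub>C graph_projector P x"
  show lin: "clinear ?G"
    using clinear_graph_projector[OF P] by (simp add: clinear_iff scaleC_add_right scaleC_scaleC
        mult.commute)
  show "graph_projector ?G = P"
  proof (rule clinear_endo_entry_eqI)
    fix a b c d :: 'h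
    have "cinner c (endo_apply (graph_projector ?G (rank_one a b)) d)
      = inverse ?n * (?n * (?n * (inverse ?n * cinner c (endo_apply (P (rank_one a b)) d))))"
      by (simp add: graph_projector_entry[OF lin] endo_apply_scaleC cinner_scaleC_right
          graph_projector_entry[OF P] mult.assoc)
    also have "\<dots> = inverse ?n * (?n * cinner c (endo_apply (P (rank_one a b)) d))"
      by (simp only: hdim_inverse_cancel_cinner)
    \<comment> \<open>Reordered so that the last pair of scalars matches
      \<open>hdim_inverse_cancel_cinner\<close>, which covers dimension 0 too.\<close>
    also have "\<dots> = ?n * (inverse ?n * cinner c (endo_apply (P (rank_one a b)) d))"
      by (rule mult.left_commute)
    finally show "cinner c (endo_apply (graph_projector ?G (rank_one a b)) d)
      = cinner c (endo_apply (P (rank_one a b)) d)"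
      unfolding hdim_inverse_cancel_cinner .
  qed (rule clinear_graph_projector[OF lin] P)+
qed

section \<open>The graph axioms translated to the graph projector\<close>

lemma cadjoint_eq_self_iff_entry:
  fixes F :: "'h::fd_hilbert endo \<Rightarrow> 'h endo"
  assumes F: "clinear F"
  shows "F\<^sup>\<dagger> = F \<longleftrightarrow> (\<forall>a b c d. cinner c (endo_apply (F (rank_one a b)) d)
    = cnj (cinner a (endo_apply (F (rank_one c d)) b)))"
proof -
  have "(\<forall>x y. cinner (F x) y = cinner x (F y))
    \<longleftrightarrow> (\<forall>a b c d. cinner (F (rank_one c d)) (rank_one a b) = cinner (rank_one c d) (F (rank_one a b)))"
    (is "_ \<longleftrightarrow> ?R")
  proof
    assume R: ?R
    show "\<forall>x y. cinner (F x) y = cinner x (F y)"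
    proof (intro allI)
      fix x y
      show "cinner (F x) y = cinner x (F y)"
        by (subst (1 2) endo_expand[of x], subst (1 2) endo_expand[of y])
          (simp add: clinear_sum[OF F] clinear_add_scaleC[OF F] cinner_sum_left cinner_sum_right
            cinner_scaleC_left cinner_scaleC_right R)
    qed
  qed simp
  \<comment> \<open>Both sides are matrix entries times dim H. This factor cancels by
    \<open>hdim_cancel_iff\<close>, also in dimension 0, where all entries vanish.\<close>
  moreover have "cinner (F (rank_one c d)) (rank_one a b) = cinner (rank_one c d) (F (rank_one a b))
    \<longleftrightarrow> cinner c (endo_apply (F (rank_one a b)) d)
      = cnj (cinner a (endo_apply (F (rank_one c d)) b))" for a b c d
  proof -
    have "cinner (F (rank_one c d)) (rank_one a b)
      = hdim TYPE('h) * cinner (endo_apply (F (rank_one c d)) b) a"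
      by (subst cinner_commute) (simp add: cinner_rank_one_left flip: cinner_commute)
    then have "cinner (F (rank_one c d)) (rank_one a b) = cinner (rank_one c d) (F (rank_one a b))
      \<longleftrightarrow> cinner (endo_apply (F (rank_one c d)) b) a = cinner c (endo_apply (F (rank_one a b)) d)"
      by (simp only: cinner_rank_one_left hdim_cancel_iff)
    then show ?thesis
      unfolding cinner_commute[of "endo_apply (F (rank_one c d)) b" a] by (rule trans) (rule eq_commute)
  qed
  ultimately show ?thesis
    unfolding cadjoint_eq_self_iff[OF F] by (simp only:)
qed

lemma adj_preserving_iff_entry:
  assumes F: "clinear F"
  shows "(\<forall>x. F (endo_adj x) = endo_adj (F x)) \<longleftrightarrow>
    (\<forall>a b c d. cinner c (endo_apply (F (rank_one a b)) d)
      = cnj (cinner d (endo_apply (F (rank_one b a)) c)))" (is "?L \<longleftrightarrow> ?R")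
proof
  assume ?L
  then have "F (rank_one a b) = endo_adj (F (rank_one b a))" for a b
    by (metis endo_adj_rank_one)
  then show ?R by (metis cinner_endo_adj_right)
next
  assume ?R
  have ro: "F (rank_one a b) = endo_adj (F (rank_one b a))" for a b
  proof (rule endo_eq_cinnerI)
    show "cinner v (endo_apply (F (rank_one a b)) w)
      = cinner v (endo_apply (endo_adj (F (rank_one b a))) w)" for v w
      unfolding cinner_endo_adj_right using \<open>?R\<close> by blast
  qed
  \<comment> \<open>The adjoint is conjugate-linear, but applying it before and after
    \<open>F\<close> gives a linear map again, so agreement on rank-one operators is enough.\<close>
  have lin: "clinear (\<lambda>x. endo_adj (F (endo_adj x)))"
    by (simp add: clinear_iff endo_adj_add endo_adj_scaleC clinear_add_scaleC[OF F])
  have "F = (\<lambda>x. endo_adj (F (endo_adj x)))"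
    using F lin by (rule clinear_endo_eqI) (simp flip: ro)
  then show ?L by (metis endo_adj_adj)
qed

text \<open>For every linear \<open>G\<close> the graph projector of the product on the left is the
  square of the graph projector of \<open>G\<close>. Injectivity of \<open>graph_projector\<close>
  then turns this identity into the equivalence.\<close>

lemma graph_projector_idempotent_iff:
  fixes G :: "'h::fd_hilbert endo \<Rightarrow> 'h endo"
  assumes G: "clinear G"
  shows "endo_mult \<circ> (G \<otimes>\<^sub>l G) \<circ> endo_mult\<^sup>\<dagger> = G
    \<longleftrightarrow> graph_projector G \<circ> graph_projector G = graph_projector G"
proof -
  let ?M = "endo_mult \<circ> (G \<otimes>\<^sub>l G) \<circ> endo_mult\<^sup>\<dagger>"
  let ?P = "graph_projector G" and ?n = "hdim TYPE('h)"
  note P = clinear_graph_projector[OF G]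
  have lin: "clinear ?M"
    by (intro clinear_comp clinear_endo_mult clinear_tensor_map clinear_endo_mult_adjoint)
  have "graph_projector ?M = ?P \<circ> ?P"
  proof (rule clinear_endo_entry_eqI)
    fix a b c d :: 'h
    \<comment> \<open>The second leg of the comultiplication meets the rank-one argument and leaves
      the scalar \<open>cinner i d\<close>; summing over \<open>i\<close> afterwards restores
      \<open>d\<close> in the first factor.\<close>
    have "?M (rank_one d b) = inverse ?n *\<^sub>C (\<Sum>i\<in>onb. \<Sum>k\<in>onb. cinner i d *\<^sub>C
        (G (rank_one i k) \<circ>\<^sub>E G (rank_one k b)))"
      by (simp add: tensor_map_endo_mult_adjoint[OF G G] clinear_sum[OF clinear_endo_mult]
          clinear_add_scaleC[OF clinear_endo_mult] rank_one_comp clinear_add_scaleC[OF G]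
          endo_comp_linear)
    also have "\<dots> = inverse ?n *\<^sub>C (\<Sum>k\<in>onb. \<Sum>i\<in>onb. cinner i d *\<^sub>C
        (G (rank_one i k) \<circ>\<^sub>E G (rank_one k b)))"
      by (subst sum.swap) (rule refl)
    also have "\<dots> = inverse ?n *\<^sub>C (\<Sum>k\<in>onb. G (rank_one d k) \<circ>\<^sub>E G (rank_one k b))"
      by (subst rank_one_expand_left[of d])
        (simp add: endo_comp_linear clinear_sum[OF G] clinear_add_scaleC[OF G])
    finally have M: "?M (rank_one d b) = \<dots>" .
    have "cinner c (endo_apply (?P (?P (rank_one a b))) d) = inverse ?n *
        (\<Sum>k\<in>onb. cinner c (endo_apply (G (rank_one d k)) (endo_apply (?P (rank_one a b)) k)))"
      by (rule graph_projector_entry_onb[OF G])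
    also have "\<dots> = inverse ?n * (\<Sum>k\<in>onb.
        inverse ?n * cinner c (endo_apply (G (rank_one d k)) (endo_apply (G (rank_one k b)) a)))"
    proof -
      \<comment> \<open>The index exchange for the inner projector, read as an identity of vectors,
        so that it can be substituted inside the outer one.\<close>
      have "endo_apply (?P (rank_one a b)) k = inverse ?n *\<^sub>C endo_apply (G (rank_one k b)) a" for k
        by (rule cinner_ext) (simp add: graph_projector_entry[OF G] cinner_scaleC_right)
      then show ?thesis
        by (simp add: clinear_add_scaleC[OF clinear_endo_apply] cinner_scaleC_right)
    qed
    finally show "cinner c (endo_apply (graph_projector ?M (rank_one a b)) d)
      = cinner c (endo_apply ((?P \<circ> ?P) (rank_one a b)) d)"
      unfolding graph_projector_entry[OF lin] M
      by (simp add: endo_apply_scaleC endo_apply_sum endo_apply_comp cinner_scaleC_right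
          cinner_sum_right sum_distrib_left)
  qed (intro clinear_graph_projector lin clinear_comp P)+
  then show ?thesis using graph_projector_inject[OF lin G] by metis
qed

text \<open>The map on the left multiplies by \<open>graph_projector G endo_id\<close> from the
  left, and left multiplication by an operator is the identity only for
  \<open>endo_id\<close>.\<close>

lemma graph_projector_unit_iff:
  fixes G :: "'h::fd_hilbert endo \<Rightarrow> 'h endo"
  assumes G: "clinear G"
  shows "endo_mult \<circ> (G \<otimes>\<^sub>l id) \<circ> endo_mult\<^sup>\<dagger> = id \<longleftrightarrow> graph_projector G endo_id = endo_id"
proof -
  have "(endo_mult \<circ> (G \<otimes>\<^sub>l id) \<circ> endo_mult\<^sup>\<dagger>) x = graph_projector G endo_id \<circ>\<^sub>E x" for x
    by (simp add: graph_projector_eq[OF G] tensor_map_endo_mult_adjoint[OF G clinear_id]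
        clinear_sum[OF clinear_endo_mult] clinear_add_scaleC[OF clinear_endo_mult]
        endo_comp_linear endo_comp_assoc)
  then show ?thesis by (metis endo_id_left endo_id_right eq_id_iff)
qed

text \<open>Bending both legs of \<open>G\<close> produces its transpose T for the bilinear form
  Tr(x y), that is Tr(T(x) y) = Tr(G(y) x). The factor 1 / dim H of the comultiplication meets the
  factor dim H of the counit.\<close>

lemma endo_transpose_eq:
  fixes G :: "'h::fd_hilbert endo \<Rightarrow> 'h endo"
  assumes G: "clinear G"
  shows "(trunit \<circ> (id \<otimes>\<^sub>l (endo_unit\<^sup>\<dagger> \<circ> endo_mult)) \<circ> (id \<otimes>\<^sub>l (G \<otimes>\<^sub>l id)) \<circ> tassoc
      \<circ> ((endo_mult\<^sup>\<dagger> \<circ> endo_unit) \<otimes>\<^sub>l id) \<circ> tlunit_inv) x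
    = (\<Sum>i\<in>onb. \<Sum>k\<in>onb. endo_trace (G (rank_one k i) \<circ>\<^sub>E x) *\<^sub>C rank_one i k)"
proof -
  let ?n = "hdim TYPE('h)"
  note lin = clinear_tensor_map clinear_id clinear_comp clinear_endo_mult clinear_endo_unit
    clinear_cadjoint clinear_endo_mult_adjoint G
  \<comment> \<open>These two factors are removed while they act on an operator, which is legitimate
    in dimension 0 because the operator is then zero.\<close>
  have *: "(inverse ?n * ?n * c) *\<^sub>C y = c *\<^sub>C (y :: 'h endo)" for c y
    using hdim_inverse_cancel[of "c *\<^sub>C y"] by (simp add: scaleC_scaleC mult.commute)
  show ?thesis
    by (simp add: tlunit_inv_def tensor_map_tensor lin endo_unit_def scaleC_one endo_mult_adjoint
        clinear_sum[OF clinear_tensor_left] clinear_add_scaleC[OF clinear_tensor_left]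
        clinear_sum[OF clinear_tassoc] clinear_add_scaleC[OF clinear_tassoc]
        clinear_sum[OF clinear_tensor_map] clinear_add_scaleC[OF clinear_tensor_map]
        clinear_sum[OF clinear_trunit] clinear_add_scaleC[OF clinear_trunit]
        tassoc_tensor trunit_tensor endo_unit_adjoint cvec.scale_sum_right scaleC_scaleC *
        flip: mult.assoc)
qed

lemma endo_transpose_iff_entry:
  fixes G :: "'h::fd_hilbert endo \<Rightarrow> 'h endo"
  assumes G: "clinear G"
  shows "trunit \<circ> (id \<otimes>\<^sub>l (endo_unit\<^sup>\<dagger> \<circ> endo_mult)) \<circ> (id \<otimes>\<^sub>l (G \<otimes>\<^sub>l id)) \<circ> tassoc
      \<circ> ((endo_mult\<^sup>\<dagger> \<circ> endo_unit) \<otimes>\<^sub>l id) \<circ> tlunit_inv = G \<longleftrightarrow>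
    (\<forall>a b c d. cinner c (endo_apply (G (rank_one a b)) d)
      = cinner b (endo_apply (G (rank_one d c)) a))" (is "?T = G \<longleftrightarrow> _")
proof -
  have lin: "clinear ?T"
  proof -
    have "clinear (tlunit_inv :: 'h endo \<Rightarrow> _)"
      using clinear_tensor_right[of "1 :: complex"] by (simp add: clinear_iff tlunit_inv_def)
    then show ?thesis by (intro clinear_comp clinear_tensor_map clinear_tassoc clinear_trunit)
  qed
  have T: "cinner c (endo_apply (?T (rank_one a b)) d)
      = cinner b (endo_apply (G (rank_one d c)) a)" for a b c d
  proof -
    have "cinner b (endo_apply (G (rank_one d c)) a)
      = (\<Sum>k\<in>onb. \<Sum>i\<in>onb. cinner k d * cinner c i * cinner b (endo_apply (G (rank_one k i)) a))"
      by (subst rank_one_expand)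
        (simp add: clinear_sum[OF G] clinear_add_scaleC[OF G] endo_apply_sum endo_apply_scaleC
          cinner_sum_right cinner_scaleC_right)
    also have "\<dots>
      = (\<Sum>i\<in>onb. \<Sum>k\<in>onb. cinner k d * cinner c i * cinner b (endo_apply (G (rank_one k i)) a))"
      by (rule sum.swap)
    finally show ?thesis
      unfolding endo_transpose_eq[OF G]
      by (simp add: endo_trace_rank_one_comp endo_apply_sum endo_apply_scaleC endo_apply_rank_one
          cinner_sum_right cinner_scaleC_right ac_simps)
  qed
  show ?thesis
    unfolding clinear_endo_eq_iff_entry[OF lin G] T by metis
qed

text \<open>In matrix entries all four conditions are index permutations, some with a conjugation.
  Self-adjointness of \<open>G\<close> is a renaming of adjoint preservation by the projector; given
  it, the transpose condition is equivalent to self-adjointness of the projector.\<close>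

lemma symmetric_iff_graph_projector:
  fixes G :: "'h::fd_hilbert endo \<Rightarrow> 'h endo"
  assumes G: "clinear G"
  shows "G\<^sup>\<dagger> = G \<and> trunit \<circ> (id \<otimes>\<^sub>l (endo_unit\<^sup>\<dagger> \<circ> endo_mult)) \<circ> (id \<otimes>\<^sub>l (G \<otimes>\<^sub>l id)) \<circ> tassoc
      \<circ> ((endo_mult\<^sup>\<dagger> \<circ> endo_unit) \<otimes>\<^sub>l id) \<circ> tlunit_inv = G
    \<longleftrightarrow> (graph_projector G)\<^sup>\<dagger> = graph_projector G
      \<and> (\<forall>x. graph_projector G (endo_adj x) = endo_adj (graph_projector G x))"
proof -
  let ?g = "\<lambda>c a b d. cinner c (endo_apply (G (rank_one a b)) d)"
  \<comment> \<open>\<open>?A\<close> is self-adjointness of \<open>G\<close>, \<open>?B\<close> its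
    transpose symmetry, \<open>?C\<close> self-adjointness of the projector and \<open>?D\<close>
    its compatibility with adjoints.\<close>
  have shuffle: "(\<forall>a b c d. g c a b d = cnj (g a c d b)) \<and> (\<forall>a b c d. g c a b d = g b d c a) \<longleftrightarrow>
      (\<forall>a b c d. g c d b a = cnj (g a b d c)) \<and> (\<forall>a b c d. g c d b a = cnj (g d c a b))"
    (is "?A \<and> ?B \<longleftrightarrow> ?C \<and> ?D") for g :: "'h \<Rightarrow> 'h \<Rightarrow> 'h \<Rightarrow> 'h \<Rightarrow> complex"
  proof -
    have "?A \<longleftrightarrow> ?D" by blast
    moreover have ?C if ?A ?B
    proof (intro allI)
      fix a b c d
      have "g c d b a = g b a c d" using that(2) by blast
      also have "\<dots> = cnj (g a b d c)" using that(1) by blast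
      finally show "g c d b a = cnj (g a b d c)" .
    qed
    moreover have ?B if ?C ?A
    proof (intro allI)
      fix a b c d
      have "g c a b d = cnj (g d b a c)" using that(1) by blast
      also have "\<dots> = g b d c a" using that(2)[rule_format, of b d c a] by simp
      finally show "g c a b d = g b d c a" .
    qed
    ultimately show ?thesis by blast
  qed
  have "(graph_projector G)\<^sup>\<dagger> = graph_projector G \<longleftrightarrow>
      (\<forall>a b c d. ?g c d b a = cnj (?g a b d c))"
    unfolding cadjoint_eq_self_iff_entry[OF clinear_graph_projector[OF G]]
    by (simp add: graph_projector_entry'[OF G] hdim_cancel_iff del: mult_cancel_left
        flip: cinner_commute)
  moreover have "(\<forall>x. graph_projector G (endo_adj x) = endo_adj (graph_projector G x)) \<longleftrightarrow>
      (\<forall>a b c d. ?g c d b a = cnj (?g d c a b))"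
    unfolding adj_preserving_iff_entry[OF clinear_graph_projector[OF G]]
    by (simp add: graph_projector_entry'[OF G] hdim_cancel_iff del: mult_cancel_left
        flip: cinner_commute)
  ultimately show ?thesis
    unfolding cadjoint_eq_self_iff_entry[OF G] endo_transpose_iff_entry[OF G]
    using shuffle[of ?g] by (simp only:)
qed

section \<open>Reflexive quantum graphs, projections and operator systems\<close>

lemma reflexive_quantum_graph_endo_iff:
  fixes G :: "'h::fd_hilbert endo \<Rightarrow> 'h endo"
  assumes "clinear G"
  shows "reflexive_quantum_graph endo_mult endo_unit G \<longleftrightarrow>
    (graph_projector G)\<^sup>\<dagger> = graph_projector G \<and>
    graph_projector G \<circ> graph_projector G = graph_projector G \<and>
    (\<forall>x. graph_projector G (endo_adj x) = endo_adj (graph_projector G x)) \<and>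
    graph_projector G endo_id = endo_id"
  unfolding reflexive_quantum_graph_def quantum_graph_def
    graph_projector_idempotent_iff[OF assms] graph_projector_unit_iff[OF assms]
  using quantum_set_endo[where 'h = 'h] assms symmetric_iff_graph_projector[OF assms] by argo

lemma reflexive_quantum_graph_clinear: "reflexive_quantum_graph m u G \<Longrightarrow> clinear G"
  by (simp add: reflexive_quantum_graph_def quantum_graph_def)

lemma operator_system_graph_operator_space:
  fixes G :: "'h::fd_hilbert endo \<Rightarrow> 'h endo"
  assumes "reflexive_quantum_graph endo_mult endo_unit G"
  shows "operator_system (graph_operator_space G)"
proof -
  let ?P = "graph_projector G"
  note G = reflexive_quantum_graph_clinear[OF assms]
  note P = iffD1[OF reflexive_quantum_graph_endo_iff[OF G] assms]
  note lin = clinear_graph_projector[OF G]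
  have "cvec.subspace (range ?P)"
    unfolding cvec.subspace_def
  proof (intro conjI ballI allI)
    show "0 \<in> range ?P"
      by (rule range_eqI[of _ _ 0]) (simp add: clinear_zero[OF lin])
    show "x + y \<in> range ?P" if "x \<in> range ?P" "y \<in> range ?P" for x y
      using that by (auto simp flip: clinear_add_scaleC(1)[OF lin])
    show "c *\<^sub>C x \<in> range ?P" if "x \<in> range ?P" for c x
      using that by (auto simp flip: clinear_add_scaleC(2)[OF lin])
  qed
  moreover have "endo_adj x \<in> range ?P" if "x \<in> range ?P" for x
  proof -
    from that obtain y where "x = ?P y" by blast
    then have "endo_adj x = ?P (endo_adj y)" using P by simp
    then show ?thesis by blast
  qed
  moreover have "endo_id \<in> range ?P"
    by (rule range_eqI[of _ _ endo_id]) (use P in simp)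
  ultimately show ?thesis unfolding operator_system_def graph_operator_space_def by blast
qed

text \<open>Conjugating \<open>P\<close> by the adjoint operation gives another orthogonal
  projection, and its range is the same because that range is closed under adjoints. Uniqueness of
  orthogonal projections identifies the two.\<close>

lemma projection_adj_preserving:
  fixes P :: "'h::fd_hilbert endo \<Rightarrow> 'h endo"
  assumes P: "clinear P" "P\<^sup>\<dagger> = P" "P \<circ> P = P"
    and adj: "\<And>x. x \<in> range P \<Longrightarrow> endo_adj x \<in> range P"
  shows "P (endo_adj x) = endo_adj (P x)"
proof -
  let ?Q = "\<lambda>x. endo_adj (P (endo_adj x))"
  have PP: "P (P x) = P x" for x using P(3) by (metis comp_apply)
  have self: "cinner (P x) y = cinner x (P y)" for x y using P by (metis cadjoint)
  have Q: "clinear ?Q"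
    by (simp add: clinear_iff endo_adj_add endo_adj_scaleC clinear_add_scaleC[OF P(1)])
  have "P = ?Q"
  proof (rule orthogonal_projection_unique[OF P Q])
    \<comment> \<open>Taking adjoints reverses the arguments of the inner product, so applying it on
      both sides of \<open>P\<close> preserves symmetry.\<close>
    have "cinner (?Q x) y = cinner x (?Q y)" for x y
      by (metis cinner_endo_adj_adj endo_adj_adj self)
    then show "?Q\<^sup>\<dagger> = ?Q" unfolding cadjoint_eq_self_iff[OF Q] by blast
    show "?Q \<circ> ?Q = ?Q" by (simp add: fun_eq_iff PP)
    have fixed: "P x = x" if "x \<in> range P" for x using that PP by auto
    \<comment> \<open>The adjoint of \<open>P x\<close> lies in the range of \<open>P\<close> and is
      fixed by it; therefore \<open>?Q\<close> fixes \<open>P x\<close>.\<close>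
    have "P x \<in> range ?Q" for x
      by (rule range_eqI[of _ _ "P x"]) (simp add: fixed[OF adj])
    moreover have "?Q x \<in> range P" for x by (intro adj rangeI)
    ultimately show "range P = range ?Q" by blast
  qed
  then show ?thesis by (metis endo_adj_adj)
qed

theorem proposition7p11:
  shows "bij_betw (graph_operator_space :: ('h::fd_hilbert endo \<Rightarrow> 'h endo) \<Rightarrow> 'h endo set)
     {G. reflexive_quantum_graph endo_mult endo_unit G}
     {V. operator_system V}"
proof (rule bij_betw_imageI)
  show "inj_on (graph_operator_space :: ('h endo \<Rightarrow> 'h endo) \<Rightarrow> 'h endo set)
      {G. reflexive_quantum_graph endo_mult endo_unit G}"
  proof (rule inj_onI, unfold mem_Collect_eq)
    fix F G :: "'h endo \<Rightarrow> 'h endo"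
    assume F: "reflexive_quantum_graph endo_mult endo_unit F"
      and G: "reflexive_quantum_graph endo_mult endo_unit G"
      and eq: "graph_operator_space F = graph_operator_space G"
    note lF = reflexive_quantum_graph_clinear[OF F] and lG = reflexive_quantum_graph_clinear[OF G]
    note PF = iffD1[OF reflexive_quantum_graph_endo_iff[OF lF] F]
      and PG = iffD1[OF reflexive_quantum_graph_endo_iff[OF lG] G]
    \<comment> \<open>Both are orthogonal projections onto the common operator system, which
      determines them.\<close>
    have "graph_projector F = graph_projector G"
    proof (rule orthogonal_projection_unique)
      show "clinear (graph_projector F)" "clinear (graph_projector G)"
        by (rule clinear_graph_projector lF lG)+
    qed (use PF PG eq in \<open>simp_all add: graph_operator_space_def\<close>)
    then show "F = G" by (rule graph_projector_inject[OF lF lG])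
  qed
  show "graph_operator_space ` {G :: 'h endo \<Rightarrow> 'h endo. reflexive_quantum_graph endo_mult endo_unit G}
      = {V. operator_system V}"
  proof (intro equalityI subsetI)
    fix V :: "'h endo set"
    assume "V \<in> {V. operator_system V}"
    then have V: "cvec.subspace V" "\<And>x. x \<in> V \<Longrightarrow> endo_adj x \<in> V" "endo_id \<in> V"
      unfolding operator_system_def by auto
    obtain P where P: "clinear P" "P\<^sup>\<dagger> = P" "P \<circ> P = P" "range P = V"
      using orthogonal_projection_exists[OF V(1)] .
    \<comment> \<open>The orthogonal projection onto \<open>V\<close> is bent back into a map
      \<open>G\<close>; the conditions still missing for a reflexive quantum graph come from closure
      of \<open>V\<close> under adjoints and from its containing the identity.\<close>
    obtain G where G: "clinear G" "graph_projector G = P"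
      using graph_projector_surj[OF P(1)] .
    have "P (endo_adj x) = endo_adj (P x)" for x
      using P V(2) by (intro projection_adj_preserving) auto
    moreover have "P endo_id = endo_id"
      using P(3,4) V(3) by (metis comp_apply imageE)
    ultimately have "reflexive_quantum_graph endo_mult endo_unit G"
      unfolding reflexive_quantum_graph_endo_iff[OF G(1)] G(2) using P by blast
    moreover have "V = graph_operator_space G"
      unfolding graph_operator_space_def G(2) P(4) by (rule refl)
    ultimately show "V \<in> graph_operator_space ` {G. reflexive_quantum_graph endo_mult endo_unit G}"
      by blast
  qed (auto intro: operator_system_graph_operator_space)
qed

end
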